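(* Let $(X,d,\mu)$ be a metric measure space, let $\Omega\subset X$ be a bounded open set, let $\nu$ be a Borel regular outer measure on $X$, and let $1\le q<p<\infty$. Define $$\gamma=\sup\left[\sum_{j=-N}^{N}\left(\frac{\nu(E_j)^{p/q}}{\operatorname{cap}_p(E_j,E_{j+1})}\right)^{q/(p-q)}\right]^{(p-q)/q},$$ where the supremum is over all positive integers $N$ and all finite sequences of sets $E_j\subset\Omega$, $j=-N,-N+1,\dots,N+1$, with $E_j\subset E_{j+1}$ for $j=-N,\dots,N$. (i) If $\gamma<\infty$, then there is a constant $c_S$, independent of $u$, such that $$\left(\int_\Omega|u|^q\,d\nu\right)^{1/q}\le c_S\left(\int_\Omega g_u^p\,d\mu\right)^{1/p}$$ for every $u\in N^{1,p}_0(\Omega)\cap C(\Omega)$ and every $p$-weak upper gradient $g_u$ of $u$. (ii) Conversely, if there is a constant $c_S$, independent of $u$, such that the inequality displayed in (i) holds for every $u\in N^{1,p}_0(\Omega)\cap C(\Omega)$ and every $p$-weak upper gradient $g_u$ of $u$, then $\gamma<\infty$.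
   Context: $(X,d)$ is a metric space and $\mu$ is a Borel regular outer measure on $X$ with $0<\mu(B)<\infty$ for every ball $B=B(x,r)=\{y\in X: d(x,y)<r\}$. A path is a rectifiable non-constant continuous map from a compact interval to $X$. A family $\Gamma$ of paths has zero $p$-modulus if there is a non-negative Borel function $\rho\in L^p(X)$ with $\int_\gamma\rho\,ds=\infty$ for all $\gamma\in\Gamma$; a property holds for $p$-almost every path if the family of paths for which it fails has zero $p$-modulus. A non-negative measurable function $g$ on $X$ is a $p$-weak upper gradient of an extended real-valued function $u$ on $X$ if for $p$-almost every path $\gamma$, with endpoints $x,y$, one has $|u(x)-u(y)|\le\int_\gamma g\,ds$ whenever $u(x),u(y)$ are both finite, and $\int_\gamma g\,ds=\infty$ otherwise. For $u\in L^p(X)$ put $\|u\|_{N^{1,p}(X)}=\left(\int_X|u|^p\,d\mu+\inf_g\int_X g^p\,d\mu\right)^{1/p}$, the infimum over all $p$-weak upper gradients $g$ of $u$; $N^{1,p}(X)$ is the space of $u$ with finite norm, modulo $u\sim v$ iff $\|u-v\|_{N^{1,p}(X)}=0$. A property holds $p$-quasieverywhere ($p$-q.e.) if it fails only on a set of $p$-capacity zero, where the $p$-capacity of $A\subset X$ is $\inf\|u\|^p_{N^{1,p}(X)}$ over $u\in N^{1,p}(X)$ with $u\ge1$ on $A$. Then $N^{1,p}_0(\Omega)=\{u|_\Omega: u\in N^{1,p}(X),\ u=0\ p\text{-q.e. on }X\setminus\Omega\}$; its elements are regarded as functions on $X$ by extending them by $0$ outside $\Omega$, and $p$-weak upper gradients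 $g_u$ are taken for this extension. $C(\Omega)$ denotes the real-valued continuous functions on $\Omega$. For $E\subset F\subset\Omega$, $\operatorname{cap}_p(E,F)=\inf\int_\Omega g_u^p\,d\mu$, where the infimum is over all functions $u:X\to\mathbb R$ that are continuous on $\Omega$ with $u=1$ on $E$ and $u=0$ on $X\setminus F$, and all $p$-weak upper gradients $g_u$ of $u$; $\operatorname{cap}_p(E,F)=\infty$ if there are no such functions. (For measurable $F$ the integral over $\Omega$ may equivalently be taken over $F$, since $g_u$ may be replaced by $0$ outside $F$.) In the definition of $\gamma$, a quotient is $0$ if its numerator is $0$ or its denominator is $\infty$, and is $\infty$ if its numerator is positive and its denominator is $0$. *)

theory Defs
  imports "HOL-Analysis.Analysis"
begin

text \<open>Powers of extended non-negative reals, for positive exponents only.\<close>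

definition epowr :: "ennreal \<Rightarrow> real \<Rightarrow> ennreal"  (infixr "epowr" 80)
  where "x epowr a = (if x = \<infinity> then \<infinity> else ennreal (enn2real x powr a))"


section \<open>Borel regular outer measures\<close>

definition borel_regular_outer_measure :: "('a::topological_space set \<Rightarrow> ennreal) \<Rightarrow> bool"
  where "borel_regular_outer_measure \<mu> \<longleftrightarrow>
    outer_measure_space (Pow UNIV) \<mu> \<and>
    sets borel \<subseteq> lambda_system UNIV (Pow UNIV) \<mu> \<and>
    (\<forall>A. \<exists>B\<in>sets borel. A \<subseteq> B \<and> \<mu> B = \<mu> A)"

text \<open>Measurability and integrals with respect to an outer measure refer to its restriction to
  the Caratheodory measurable sets.\<close>

definition om_measure :: "('a set \<Rightarrow> ennreal) \<Rightarrow> 'a measure"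
  where "om_measure \<mu> = measure_of UNIV (lambda_system UNIV (Pow UNIV) \<mu>) \<mu>"

lemma om_measure_simps:
  assumes "outer_measure_space (Pow UNIV) \<mu>"
  shows space_om_measure: "space (om_measure \<mu>) = UNIV"
    and sets_om_measure: "sets (om_measure \<mu>) = lambda_system UNIV (Pow UNIV) \<mu>"
    and emeasure_om_measure:
      "A \<in> lambda_system UNIV (Pow UNIV) \<mu> \<Longrightarrow> emeasure (om_measure \<mu>) A = \<mu> A"
proof -
  interpret sigma_algebra UNIV "Pow UNIV :: 'a set set"
    by (rule sigma_algebra_Pow)
  have ms: "measure_space UNIV (lambda_system UNIV (Pow UNIV) \<mu>) \<mu>"
    using caratheodory_lemma[OF assms] by simp
  then have sa: "sigma_algebra UNIV (lambda_system UNIV (Pow UNIV) \<mu>)"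
    by (simp add: measure_space_def)
  show "space (om_measure \<mu>) = UNIV"
    by (simp add: om_measure_def space_measure_of_conv)
  show "sets (om_measure \<mu>) = lambda_system UNIV (Pow UNIV) \<mu>"
    unfolding om_measure_def by (rule sigma_algebra.sets_measure_of_eq[OF sa])
  show "emeasure (om_measure \<mu>) A = \<mu> A" if "A \<in> lambda_system UNIV (Pow UNIV) \<mu>"
    unfolding om_measure_def
    using emeasure_measure_of_sigma[OF sa _ _ that] ms by (simp add: measure_space_def)
qed


section \<open>Paths, path integrals and modulus\<close>

text \<open>A triple \<open>(a, b, \<gamma>)\<close> stands for the restriction of \<open>\<gamma>\<close> to the compact
  interval \<open>{a..b}\<close>; the values of \<open>\<gamma>\<close> elsewhere are irrelevant.\<close>

type_synonym 'a interval_path = "real \<times> real \<times> (real \<Rightarrow> 'a)"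

definition path_length :: "(real \<Rightarrow> 'a::metric_space) \<Rightarrow> real \<Rightarrow> real \<Rightarrow> ennreal"
  where "path_length \<gamma> a b =
    (SUP (n, t) \<in> {(n::nat, t::nat \<Rightarrow> real). t ` {..n} \<subseteq> {a..b} \<and> (\<forall>i<n. t i \<le> t (Suc i))}.
       \<Sum>i<n. ennreal (dist (\<gamma> (t i)) (\<gamma> (t (Suc i)))))"

definition rect_paths :: "'a::metric_space interval_path set"
  where "rect_paths = {(a, b, \<gamma>). a \<le> b \<and> continuous_on {a..b} \<gamma> \<and>
    path_length \<gamma> a b < \<infinity> \<and> \<not> \<gamma> constant_on {a..b}}"

text \<open>For a rectifiable path every \<open>s\<close> between \<open>0\<close> and the length is attained
  by the length function, and \<open>\<gamma>\<close> is constant on the set of parameters at which \<open>s\<close> is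
  attained, so the choice is immaterial.\<close>

definition arclength_param :: "'a::metric_space interval_path \<Rightarrow> real \<Rightarrow> 'a"
  where "arclength_param = (\<lambda>(a, b, \<gamma>) s.
    \<gamma> (SOME t. t \<in> {a..b} \<and> path_length \<gamma> a t = ennreal s))"

text \<open>If \<open>g\<close> is only \<open>\<mu>\<close>-measurable, then \<open>g\<close> composed with the path need not be
  measurable, and the right-hand side is then a lower integral.  For \<open>g\<close> measurable with respect to
  a Borel regular outer measure, finite on balls, this happens only on a family of paths of zero
  modulus, which is ignored in the definition of weak upper gradients.\<close>

definition path_integral :: "'a::metric_space interval_path \<Rightarrow> ('a \<Rightarrow> ennreal) \<Rightarrow> ennreal"
  where "path_integral = (\<lambda>(a, b, \<gamma>) g.
    \<integral>\<^sup>+s\<in>{0..enn2real (path_length \<gamma> a b)}. g (arclength_param (a, b, \<gamma>) s) \<partial>lebesgue)"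

definition zero_modulus ::
    "('a::metric_space set \<Rightarrow> ennreal) \<Rightarrow> real \<Rightarrow> 'a interval_path set \<Rightarrow> bool"
  where "zero_modulus \<mu> p \<Gamma> \<longleftrightarrow>
    (\<exists>\<rho>\<in>borel_measurable borel. (\<integral>\<^sup>+x. \<rho> x epowr p \<partial>om_measure \<mu>) < \<infinity> \<and>
       (\<forall>c\<in>\<Gamma>. path_integral c \<rho> = \<infinity>))"

definition almost_every_path ::
    "('a::metric_space set \<Rightarrow> ennreal) \<Rightarrow> real \<Rightarrow> ('a interval_path \<Rightarrow> bool) \<Rightarrow> bool"
  where "almost_every_path \<mu> p P \<longleftrightarrow> zero_modulus \<mu> p {c \<in> rect_paths. \<not> P c}"


section \<open>Weak upper gradients and Newtonian spaces\<close>

definition weak_upper_gradient ::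
    "('a::metric_space set \<Rightarrow> ennreal) \<Rightarrow> real \<Rightarrow> ('a \<Rightarrow> ereal) \<Rightarrow> ('a \<Rightarrow> ennreal) \<Rightarrow> bool"
  where "weak_upper_gradient \<mu> p u g \<longleftrightarrow> g \<in> borel_measurable (om_measure \<mu>) \<and>
    almost_every_path \<mu> p (\<lambda>(a, b, \<gamma>).
      if \<bar>u (\<gamma> a)\<bar> \<noteq> \<infinity> \<and> \<bar>u (\<gamma> b)\<bar> \<noteq> \<infinity>
      then e2ennreal \<bar>u (\<gamma> a) - u (\<gamma> b)\<bar> \<le> path_integral (a, b, \<gamma>) g
      else path_integral (a, b, \<gamma>) g = \<infinity>)"

definition newtonian_norm ::
    "('a::metric_space set \<Rightarrow> ennreal) \<Rightarrow> real \<Rightarrow> ('a \<Rightarrow> ereal) \<Rightarrow> ennreal"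
  where "newtonian_norm \<mu> p u =
    ((\<integral>\<^sup>+x. e2ennreal \<bar>u x\<bar> epowr p \<partial>om_measure \<mu>) +
     (INF g \<in> {g. weak_upper_gradient \<mu> p u g}. \<integral>\<^sup>+x. g x epowr p \<partial>om_measure \<mu>)) epowr (1 / p)"

text \<open>The elements are functions rather than equivalence classes: everything below concerns
  pointwise properties of representatives.  Finiteness of the norm includes membership in
  \<open>L\<^sup>p\<close>.\<close>

definition newtonian_space :: "('a::metric_space set \<Rightarrow> ennreal) \<Rightarrow> real \<Rightarrow> ('a \<Rightarrow> ereal) set"
  where "newtonian_space \<mu> p =
    {u \<in> borel_measurable (om_measure \<mu>). newtonian_norm \<mu> p u < \<infinity>}"

definition sobolev_capacity :: "('a::metric_space set \<Rightarrow> ennreal) \<Rightarrow> real \<Rightarrow> 'a set \<Rightarrow> ennreal"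
  where "sobolev_capacity \<mu> p A =
    (INF u \<in> {u \<in> newtonian_space \<mu> p. \<forall>x\<in>A. 1 \<le> u x}. newtonian_norm \<mu> p u epowr p)"

definition quasieverywhere_on ::
    "('a::metric_space set \<Rightarrow> ennreal) \<Rightarrow> real \<Rightarrow> 'a set \<Rightarrow> ('a \<Rightarrow> bool) \<Rightarrow> bool"
  where "quasieverywhere_on \<mu> p A P \<longleftrightarrow> sobolev_capacity \<mu> p {x \<in> A. \<not> P x} = 0"

text \<open>Functions on \<open>\<Omega>\<close> are represented by their extensions by \<open>0\<close> to the whole space.\<close>

definition newtonian_space_0 ::
    "('a::metric_space set \<Rightarrow> ennreal) \<Rightarrow> real \<Rightarrow> 'a set \<Rightarrow> ('a \<Rightarrow> ereal) set"
  where "newtonian_space_0 \<mu> p \<Omega> = {(\<lambda>x. if x \<in> \<Omega> then v x else 0) | v.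
    v \<in> newtonian_space \<mu> p \<and> quasieverywhere_on \<mu> p (- \<Omega>) (\<lambda>x. v x = 0)}"

text \<open>The real-valued functions on the whole space which vanish outside \<open>\<Omega>\<close> and whose
  restrictions to \<open>\<Omega>\<close> form the intersection of \<open>N\<^sup>1\<^sup>,\<^sup>p\<^sub>0(\<Omega>)\<close> with \<open>C(\<Omega>)\<close>.\<close>

definition newtonian_0_cont ::
    "('a::metric_space set \<Rightarrow> ennreal) \<Rightarrow> real \<Rightarrow> 'a set \<Rightarrow> ('a \<Rightarrow> real) set"
  where "newtonian_0_cont \<mu> p \<Omega> =
    {u. (\<lambda>x. ereal (u x)) \<in> newtonian_space_0 \<mu> p \<Omega> \<and> continuous_on \<Omega> u}"


section \<open>Condenser capacity and the quantity \<open>\<gamma>\<close>\<close>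

text \<open>The infimum over the empty set is \<open>\<infinity>\<close> in \<^typ>\<open>ennreal\<close>.\<close>

definition cap ::
    "('a::metric_space set \<Rightarrow> ennreal) \<Rightarrow> real \<Rightarrow> 'a set \<Rightarrow> 'a set \<Rightarrow> 'a set \<Rightarrow> ennreal"
  where "cap \<mu> p \<Omega> E F =
    (INF (u, g) \<in> {(u :: 'a \<Rightarrow> real, g). continuous_on \<Omega> u \<and> (\<forall>x\<in>E. u x = 1) \<and>
        (\<forall>x\<in>- F. u x = 0) \<and> weak_upper_gradient \<mu> p (\<lambda>x. ereal (u x)) g}.
       \<integral>\<^sup>+x\<in>\<Omega>. g x epowr p \<partial>om_measure \<mu>)"

text \<open>Division on \<^typ>\<open>ennreal\<close> follows the conventions needed for the quotients in the
  definition of \<open>\<gamma>\<close>.\<close>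

lemma ennreal_quotient_conventions:
  fixes x :: ennreal
  shows "0 / x = 0" "x / \<infinity> = 0" "0 < x \<Longrightarrow> x / 0 = \<infinity>"
  by (auto simp: divide_ennreal_def ennreal_mult_eq_top_iff)

definition capacitary_gamma ::
    "('a::metric_space set \<Rightarrow> ennreal) \<Rightarrow> ('a set \<Rightarrow> ennreal) \<Rightarrow> real \<Rightarrow> real \<Rightarrow> 'a set \<Rightarrow> ennreal"
  where "capacitary_gamma \<mu> \<nu> p q \<Omega> =
    (SUP (N, E) \<in> {(N::nat, E::int \<Rightarrow> 'a set). 0 < N \<and>
        (\<forall>j\<in>{- int N..int N + 1}. E j \<subseteq> \<Omega>) \<and> (\<forall>j\<in>{- int N..int N}. E j \<subseteq> E (j + 1))}.
       (\<Sum>j = - int N..int N.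
          (\<nu> (E j) epowr (p / q) / cap \<mu> p \<Omega> (E j) (E (j + 1))) epowr (q / (p - q)))
       epowr ((p - q) / q))"

end

theory Submission
  imports Defs
begin

text \<open>The proof is Maz'ya's truncation method.  Its analytic core is
  \<open>weak_upper_gradient_truncation\<close>: if \<open>u\<close> is cut off at two levels, its weak upper gradient may
  be restricted to the strip between the levels.  Along almost every path this is the elementary
  observation that, between the last visit to the lower level and the next visit to the upper one,
  the path stays inside the strip; it requires that almost every path inherits the upper gradient
  inequality on all subpaths, and hence the additivity and continuity of arc length.  Strips between
  consecutive levels are disjoint, so energies of truncations can be added without loss.

  If \<open>\<gamma>\<close> is finite, apply this to the superlevel sets of \<open>\<bar>u\<bar>\<close> at the levels \<open>2\<^bsup>-j\<^esup>\<close>.  Truncations of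
  \<open>\<bar>u\<bar>\<close> are competitors for the capacities of consecutive superlevel sets, so that the sum of the
  capacities with weights \<open>2\<^bsup>-jp\<^esup>\<close> is controlled by the energy of \<open>u\<close>, while the integral of
  \<open>\<bar>u\<bar>\<^bsup>q\<^esup>\<close> is controlled by the sum of the \<open>\<nu>\<close>-measures with weights \<open>2\<^bsup>-jq\<^esup>\<close>.  Hoelder's inequality
  for sums compares the two by means of \<open>\<gamma>\<close>
  (\<open>level_set_capacities\<close>, \<open>dyadic_levels_bound\<close>, \<open>sobolev_inequality_of_capacitary_gamma\<close>).

  Conversely, given a finite sequence of sets, a combination of truncated, nearly optimal
  competitors for the capacities of consecutive sets is a test function for the Sobolev inequality
  (\<open>nested_condensers_test_function\<close>).  For the coefficients for which Hoelder's inequality is an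
  equality, the Sobolev inequality bounds a power of the capacitary sum by a smaller power of the same
  sum, which bounds the sum itself (\<open>capacitary_gamma_le\<close>).\<close>

section \<open>Powers of extended non-negative reals\<close>

lemma epowr_ennreal: "0 \<le> x \<Longrightarrow> ennreal x epowr a = ennreal (x powr a)"
  by (simp add: epowr_def)

lemma top_epowr [simp]: "top epowr a = top"
  by (simp add: epowr_def)

lemma zero_epowr [simp]: "0 epowr a = 0"
  by (simp add: epowr_def)

lemma epowr_1 [simp]: "x epowr 1 = x"
  by (cases x) (auto simp: epowr_ennreal)

lemma epowr_eq_0_iff [simp]: "x epowr a = 0 \<longleftrightarrow> x = 0"
  by (cases x) (auto simp: epowr_ennreal)

lemma epowr_eq_top_iff [simp]: "x epowr a = top \<longleftrightarrow> x = top"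
  by (cases x) (auto simp: epowr_ennreal)

lemma epowr_less_top_iff [simp]: "x epowr a < top \<longleftrightarrow> x < top"
  by (simp add: less_top[symmetric])

lemma epowr_mono: "0 \<le> a \<Longrightarrow> x \<le> y \<Longrightarrow> x epowr a \<le> y epowr a"
  by (cases x; cases y) (auto simp: epowr_ennreal top_unique intro!: ennreal_leI powr_mono2)

lemma epowr_epowr: "(x epowr a) epowr b = x epowr (a * b)"
  by (cases x) (auto simp: epowr_ennreal powr_powr)

lemma epowr_mult: "(x * y) epowr a = x epowr a * y epowr a"
proof (cases "x = top \<or> y = top")
  case True
  then show ?thesis by (cases "x = 0 \<or> y = 0") (auto simp: ennreal_top_mult ennreal_mult_top)
next
  case False
  then obtain r s where "x = ennreal r" "0 \<le> r" "y = ennreal s" "0 \<le> s"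
    by (cases x; cases y) auto
  then show ?thesis
    by (simp add: epowr_ennreal ennreal_mult[symmetric] powr_mult)
qed

lemma epowr_le_iff: "0 < a \<Longrightarrow> x epowr a \<le> y \<longleftrightarrow> x \<le> y epowr (1 / a)"
  using epowr_mono[of "1/a" "x epowr a" y] epowr_mono[of a x "y epowr (1/a)"]
  by (auto simp: epowr_epowr)

lemma borel_measurable_epowr [measurable]:
  assumes [measurable]: "f \<in> borel_measurable M"
  shows "(\<lambda>x. f x epowr a) \<in> borel_measurable M"
  unfolding epowr_def by measurable

lemma epowr_max_le: "max x y epowr a \<le> x epowr a + y epowr a"
  by (simp add: max_def)


section \<open>Integrals of functions that need not be measurable\<close>

text \<open>For a function that is not measurable, \<^const>\<open>nn_integral\<close> is the lower integral, since it
  is the supremum over the simple functions below it.  It is superadditive and superhomogeneous,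
  which is the direction needed to add up upper gradients, and it is invariant under isometries of
  the line.\<close>

lemma ennreal_SUP_add_SUP_le:
  fixes f :: "'a \<Rightarrow> ennreal" and g :: "'b \<Rightarrow> ennreal"
  assumes "I \<noteq> {}" "J \<noteq> {}" "\<And>i j. i \<in> I \<Longrightarrow> j \<in> J \<Longrightarrow> f i + g j \<le> K"
  shows "(SUP i\<in>I. f i) + (SUP j\<in>J. g j) \<le> K"
proof -
  have "(SUP i\<in>I. f i) + (SUP j\<in>J. g j) = (SUP i\<in>I. SUP j\<in>J. f i + g j)"
    using assms(1,2) by (simp add: ennreal_SUP_add_left ennreal_SUP_add_right[symmetric])
  also have "\<dots> \<le> K"
    using assms(3) by (intro SUP_least) auto
  finally show ?thesis .
qed

lemma nn_integral_superadd:
  "(\<integral>\<^sup>+x. f x \<partial>M) + (\<integral>\<^sup>+x. g x \<partial>M) \<le> (\<integral>\<^sup>+x. f x + g x \<partial>M)"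
proof -
  have ne: "{h. simple_function M h \<and> h \<le> f} \<noteq> {}" for f :: "'a \<Rightarrow> ennreal"
    by (auto intro!: exI[of _ "\<lambda>_. 0"] simp: le_fun_def)
  have "integral\<^sup>S M s + integral\<^sup>S M t \<le> (\<integral>\<^sup>+x. f x + g x \<partial>M)"
    if "simple_function M s" "s \<le> f" "simple_function M t" "t \<le> g" for s t
  proof -
    have "integral\<^sup>S M s + integral\<^sup>S M t = integral\<^sup>S M (\<lambda>x. s x + t x)"
      using that by (simp add: simple_integral_add)
    also have "\<dots> \<le> (\<integral>\<^sup>+x. f x + g x \<partial>M)"
      unfolding nn_integral_def using that
      by (intro SUP_upper) (auto simp: le_fun_def intro!: add_mono)
    finally show ?thesis .
  qed
  then show ?thesis
    unfolding nn_integral_def[of M f] nn_integral_def[of M g]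
    by (intro ennreal_SUP_add_SUP_le ne) auto
qed

lemma nn_integral_superhomogeneous:
  "c * (\<integral>\<^sup>+x. f x \<partial>M) \<le> (\<integral>\<^sup>+x. c * f x \<partial>M)" for c :: ennreal
proof -
  have "c * integral\<^sup>S M s \<le> (\<integral>\<^sup>+x. c * f x \<partial>M)" if "simple_function M s" "s \<le> f" for s
  proof -
    have "c * integral\<^sup>S M s = integral\<^sup>S M (\<lambda>x. c * s x)"
      using that by (simp add: simple_integral_mult)
    also have "\<dots> \<le> (\<integral>\<^sup>+x. c * f x \<partial>M)"
      unfolding nn_integral_def using that
      by (intro SUP_upper) (auto simp: le_fun_def intro!: mult_left_mono)
    finally show ?thesis .
  qed
  then show ?thesis
    unfolding nn_integral_def[of M f] SUP_mult_left_ennreal by (auto intro!: SUP_least)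
qed

lemma nn_integral_sum_le:
  fixes f :: "'i \<Rightarrow> 'a \<Rightarrow> ennreal"
  shows "(\<Sum>i\<in>I. \<integral>\<^sup>+x. f i x \<partial>M) \<le> (\<integral>\<^sup>+x. (\<Sum>i\<in>I. f i x) \<partial>M)"
proof (induction I rule: infinite_finite_induct)
  case (insert i I)
  have "(\<Sum>i\<in>insert i I. \<integral>\<^sup>+x. f i x \<partial>M) \<le> (\<integral>\<^sup>+x. f i x \<partial>M) + (\<integral>\<^sup>+x. (\<Sum>i\<in>I. f i x) \<partial>M)"
    using insert by (auto intro!: add_left_mono)
  also have "\<dots> \<le> (\<integral>\<^sup>+x. f i x + (\<Sum>i\<in>I. f i x) \<partial>M)"
    by (rule nn_integral_superadd)
  finally show ?case using insert by simp
qed auto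

lemma nn_integral_le_measure_preserving:
  assumes T: "T \<in> M \<rightarrow>\<^sub>M N" and N: "distr M N T = N"
  shows "(\<integral>\<^sup>+x. f x \<partial>N) \<le> (\<integral>\<^sup>+x. f (T x) \<partial>M)"
proof -
  have "integral\<^sup>S N s \<le> (\<integral>\<^sup>+x. f (T x) \<partial>M)" if s: "simple_function N s" "s \<le> f" for s
  proof -
    have "integral\<^sup>S N s = (\<integral>\<^sup>+x. s x \<partial>distr M N T)"
      using s by (simp add: N nn_integral_eq_simple_integral)
    also have "\<dots> = (\<integral>\<^sup>+x. s (T x) \<partial>M)"
      using s T by (intro nn_integral_distr) (auto intro: borel_measurable_simple_function)
    also have "\<dots> \<le> (\<integral>\<^sup>+x. f (T x) \<partial>M)"
      using s by (auto intro!: nn_integral_mono simp: le_fun_def)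
    finally show ?thesis .
  qed
  then show ?thesis
    unfolding nn_integral_def[of N f] by (auto intro!: SUP_least)
qed

lemma nn_integral_lebesgue_isometry:
  fixes f :: "real \<Rightarrow> ennreal"
  assumes "\<bar>m\<bar> = 1"
  shows "(\<integral>\<^sup>+x. f (t + m * x) \<partial>lebesgue) = (\<integral>\<^sup>+x. f x \<partial>lebesgue)"
proof -
  have m: "m \<noteq> 0" "m * m = 1" using assms by (auto simp: abs_if split: if_splits)
  have le: "(\<integral>\<^sup>+x. f x \<partial>lebesgue) \<le> (\<integral>\<^sup>+x. f (t + m * x) \<partial>lebesgue)" for f :: "real \<Rightarrow> ennreal" and t
  proof (rule nn_integral_le_measure_preserving)
    show "(\<lambda>x. t + m * x) \<in> lebesgue \<rightarrow>\<^sub>M lebesgue"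
      using lebesgue_affine_measurable[of "\<lambda>_::real. m" t] m by simp
    show "distr lebesgue lebesgue (\<lambda>x. t + m * x) = (lebesgue :: real measure)"
      using lebesgue_real_affine[of m t] assms m by (simp add: density_1)
  qed
  have "(\<integral>\<^sup>+x. f (t + m * x) \<partial>lebesgue) \<le> (\<integral>\<^sup>+x. f (t + m * (- m * t + m * x)) \<partial>lebesgue)"
    by (rule le)
  also have "(\<lambda>x. f (t + m * (- m * t + m * x))) = f"
    using m(2) by (auto simp: algebra_simps fun_eq_iff mult.assoc[symmetric])
  finally show ?thesis using le by (intro antisym)
qed


section \<open>Length and arc length parametrization\<close>

lemma path_length_upper:
  assumes "t ` {..n} \<subseteq> {a..b}" "\<And>i. i < n \<Longrightarrow> t i \<le> t (Suc i)"
  shows "ennreal (\<Sum>i<n. dist (\<gamma> (t i)) (\<gamma> (t (Suc i)))) \<le> path_length \<gamma> a b"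
proof -
  have "(n, t) \<in> {(n, t). t ` {..n} \<subseteq> {a..b} \<and> (\<forall>i<n. t i \<le> t (Suc i))}"
    using assms by auto
  from SUP_upper[OF this, of "\<lambda>(n, t). \<Sum>i<n. ennreal (dist (\<gamma> (t i)) (\<gamma> (t (Suc i))))"]
  show ?thesis unfolding path_length_def by (simp add: sum_ennreal)
qed

lemma path_length_least:
  assumes "\<And>n t. t ` {..n} \<subseteq> {a..b} \<Longrightarrow> (\<And>i. i < n \<Longrightarrow> t i \<le> t (Suc i)) \<Longrightarrow>
    ennreal (\<Sum>i<n. dist (\<gamma> (t i)) (\<gamma> (t (Suc i)))) \<le> K"
  shows "path_length \<gamma> a b \<le> K"
  unfolding path_length_def using assms by (intro SUP_least) (auto simp: sum_ennreal)

lemma dist_le_path_length: "s \<le> t \<Longrightarrow> ennreal (dist (\<gamma> s) (\<gamma> t)) \<le> path_length \<gamma> s t"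
  using path_length_upper[of "\<lambda>i. if i = 0 then s else t" 1 s t \<gamma>] by (auto simp: image_subset_iff)

lemma path_length_refl [simp]: "path_length \<gamma> a a = 0"
proof -
  have "path_length \<gamma> a a \<le> 0"
  proof (rule path_length_least)
    fix n :: nat and t :: "nat \<Rightarrow> real" assume t: "t ` {..n} \<subseteq> {a..a}"
    have "dist (\<gamma> (t i)) (\<gamma> (t (Suc i))) = 0" if "i < n" for i
    proof -
      have "t i \<in> {a..a}" "t (Suc i) \<in> {a..a}"
        using that t by (auto simp: image_subset_iff)
      then show ?thesis by simp
    qed
    then show "ennreal (\<Sum>i<n. dist (\<gamma> (t i)) (\<gamma> (t (Suc i)))) \<le> 0"
      by simp
  qed
  then show ?thesis by simp
qed

text \<open>Cutting all parameters of a subdivision at \<open>b\<close> gives subdivisions of the two halves; only the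
  interval that contains \<open>b\<close> needs the triangle inequality.\<close>

lemma variation_cut_le:
  fixes \<gamma> :: "real \<Rightarrow> 'a::metric_space"
  assumes "\<And>i. i < n \<Longrightarrow> t i \<le> t (Suc i)"
  shows "(\<Sum>i<n. dist (\<gamma> (t i)) (\<gamma> (t (Suc i))))
    \<le> (\<Sum>i<n. dist (\<gamma> (min (t i) b)) (\<gamma> (min (t (Suc i)) b)))
     + (\<Sum>i<n. dist (\<gamma> (max (t i) b)) (\<gamma> (max (t (Suc i)) b)))"
  unfolding sum.distrib[symmetric]
proof (rule sum_mono)
  fix i assume "i \<in> {..<n}"
  then have "t i \<le> t (Suc i)" using assms by auto
  then show "dist (\<gamma> (t i)) (\<gamma> (t (Suc i)))
      \<le> dist (\<gamma> (min (t i) b)) (\<gamma> (min (t (Suc i)) b)) + dist (\<gamma> (max (t i) b)) (\<gamma> (max (t (Suc i)) b))"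
    by (auto simp: min_def max_def dist_triangle)
qed

lemma path_length_lower_part:
  assumes "t ` {..n} \<subseteq> {a..c}" "\<And>i. i < n \<Longrightarrow> t i \<le> t (Suc i)" "a \<le> b"
  shows "ennreal (\<Sum>i<n. dist (\<gamma> (min (t i) b)) (\<gamma> (min (t (Suc i)) b))) \<le> path_length \<gamma> a b"
  using assms(1,3)
  by (intro path_length_upper[where t = "\<lambda>i. min (t i) b"] min.mono assms(2))
    (auto simp: image_subset_iff)

lemma path_length_upper_part:
  assumes "t ` {..n} \<subseteq> {a..c}" "\<And>i. i < n \<Longrightarrow> t i \<le> t (Suc i)" "b \<le> c"
  shows "ennreal (\<Sum>i<n. dist (\<gamma> (max (t i) b)) (\<gamma> (max (t (Suc i)) b))) \<le> path_length \<gamma> b c"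
  using assms(1,3)
  by (intro path_length_upper[where t = "\<lambda>i. max (t i) b"] max.mono assms(2))
    (auto simp: image_subset_iff)

lemma path_length_superadd:
  fixes \<gamma> :: "real \<Rightarrow> 'a::metric_space"
  assumes "a \<le> b" "b \<le> c"
  shows "path_length \<gamma> a b + path_length \<gamma> b c \<le> path_length \<gamma> a c"
  unfolding path_length_def[of \<gamma> a b] path_length_def[of \<gamma> b c]
proof (rule ennreal_SUP_add_SUP_le, goal_cases)
  case 1
  show ?case using assms by (auto intro!: exI[of _ 0] exI[of _ "\<lambda>_. a"])
next
  case 2
  show ?case using assms by (auto intro!: exI[of _ 0] exI[of _ "\<lambda>_. b"])
next
  case (3 P Q)
  obtain n t m s where PQ: "P = (n, t)" "Q = (m, s)" by (metis surj_pair)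
  with 3 have t: "\<And>i. i \<le> n \<Longrightarrow> a \<le> t i \<and> t i \<le> b" "\<And>i. i < n \<Longrightarrow> t i \<le> t (Suc i)"
    and s: "\<And>i. i \<le> m \<Longrightarrow> b \<le> s i \<and> s i \<le> c" "\<And>i. i < m \<Longrightarrow> s i \<le> s (Suc i)"
    by (auto simp: image_subset_iff)
  \<comment> \<open>Concatenating the two subdivisions adds one step from \<open>t n\<close> to \<open>s 0\<close>, which only increases
    the variation.\<close>
  define u where "u i = (if i \<le> n then t i else s (i - Suc n))" for i
  define d where "d i = dist (\<gamma> (u i)) (\<gamma> (u (Suc i)))" for i
  have split: "(\<Sum>i<n + k. d i) = (\<Sum>i<n. d i) + (\<Sum>i<k. d (n + i))" for k
    by (induction k) auto
  have "(\<Sum>i<n. dist (\<gamma> (t i)) (\<gamma> (t (Suc i)))) + (\<Sum>i<m. dist (\<gamma> (s i)) (\<gamma> (s (Suc i))))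
    \<le> (\<Sum>i<n. d i) + (\<Sum>i<Suc m. d (n + i))"
    unfolding sum.lessThan_Suc_shift by (intro add_mono) (auto simp: d_def u_def)
  also have "\<dots> = (\<Sum>i<n + Suc m. d i)"
    by (simp only: split)
  finally have "ennreal ((\<Sum>i<n. dist (\<gamma> (t i)) (\<gamma> (t (Suc i)))) + (\<Sum>i<m. dist (\<gamma> (s i)) (\<gamma> (s (Suc i)))))
    \<le> ennreal (\<Sum>i<n + Suc m. d i)"
    by (rule ennreal_leI)
  also have "\<dots> \<le> path_length \<gamma> a c"
    unfolding d_def
  proof (rule path_length_upper)
    show "u ` {..n + Suc m} \<subseteq> {a..c}"
    proof (rule image_subsetI)
      fix i assume "i \<in> {..n + Suc m}"
      then have "i \<le> n \<or> i - Suc n \<le> m" by auto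
      then show "u i \<in> {a..c}"
        using t(1)[of i] s(1)[of "i - Suc n"] \<open>i \<in> _\<close> assms
        by (cases "i \<le> n") (auto simp: u_def)
    qed
    show "u i \<le> u (Suc i)" if "i < n + Suc m" for i
    proof -
      consider "i < n" | "i = n" | "Suc n \<le> i" by linarith
      then show ?thesis
      proof cases
        case 3
        then have "u i = s (i - Suc n)" "u (Suc i) = s (Suc (i - Suc n))"
          by (auto simp: u_def Suc_diff_Suc)
        with s(2)[of "i - Suc n"] 3 that show ?thesis by simp
      qed (use t(1)[of n] s(1)[of 0] t(2)[of i] in \<open>auto simp: u_def\<close>)
    qed
  qed
  finally show ?case
    by (simp add: PQ sum_ennreal ennreal_plus sum_nonneg)
qed

lemma path_length_add:
  assumes "a \<le> b" "b \<le> c"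
  shows "path_length \<gamma> a b + path_length \<gamma> b c = path_length \<gamma> a c"
proof (rule antisym[OF path_length_superadd[OF assms]], rule path_length_least)
  fix n t assume t: "t ` {..n} \<subseteq> {a..c}" "\<And>i. i < n \<Longrightarrow> t i \<le> t (Suc i)"
  show "ennreal (\<Sum>i<n. dist (\<gamma> (t i)) (\<gamma> (t (Suc i)))) \<le> path_length \<gamma> a b + path_length \<gamma> b c"
    using ennreal_leI[OF variation_cut_le[of n t \<gamma> b, OF t(2)]]
      add_mono[OF path_length_lower_part[of t n a c b \<gamma>, OF t assms(1)]
        path_length_upper_part[of t n a c b \<gamma>, OF t assms(2)]]
    by (simp add: ennreal_plus sum_nonneg)
qed

text \<open>Constant maps are admitted, so that subpaths are again of this kind.\<close>

locale rectifiable_path =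
  fixes \<gamma> :: "real \<Rightarrow> 'a::metric_space" and a b :: real
  assumes a_le_b: "a \<le> b"
    and continuous: "continuous_on {a..b} \<gamma>"
    and finite_length: "path_length \<gamma> a b < \<infinity>"
begin

definition len :: "real \<Rightarrow> real"
  where "len x = enn2real (path_length \<gamma> a x)"

abbreviation \<alpha> :: "real \<Rightarrow> 'a"
  where "\<alpha> \<equiv> arclength_param (a, b, \<gamma>)"

lemma path_length_eq_len:
  assumes "a \<le> x" "x \<le> b"
  shows "path_length \<gamma> a x = ennreal (len x)"
proof -
  have "path_length \<gamma> a x \<le> path_length \<gamma> a b"
    by (simp flip: path_length_add[OF assms])
  then show ?thesis
    using finite_length by (simp add: len_def)
qed

lemma len_nonneg [simp]: "0 \<le> len x"
  by (simp add: len_def)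

lemma len_a [simp]: "len a = 0"
  by (simp add: len_def)

lemma path_length_sub:
  assumes "a \<le> x" "x \<le> y" "y \<le> b"
  shows "path_length \<gamma> x y = ennreal (len y - len x)" and "len x \<le> len y"
proof -
  have eq: "ennreal (len x) + path_length \<gamma> x y = ennreal (len y)"
    using path_length_add[of a x y \<gamma>] path_length_eq_len[of x] path_length_eq_len[of y] assms by simp
  then obtain r where r: "path_length \<gamma> x y = ennreal r" "0 \<le> r"
    by (cases "path_length \<gamma> x y") auto
  with eq have "ennreal (len x + r) = ennreal (len y)"
    by simp
  with r have "len x + r = len y"
    by (subst (asm) ennreal_inj) auto
  with r show "path_length \<gamma> x y = ennreal (len y - len x)" "len x \<le> len y"
    by auto
qed

lemma dist_le_len:
  assumes "a \<le> x" "x \<le> y" "y \<le> b"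
  shows "dist (\<gamma> x) (\<gamma> y) \<le> len y - len x"
  using dist_le_path_length[of x y \<gamma>] path_length_sub[OF assms] assms
  by (auto simp: ennreal_le_iff2)

text \<open>The length of the initial piece up to \<open>x\<close> differs from the variation over the part below \<open>x\<close>
  of a subdivision by at most the defect of that subdivision on the whole interval.  Hence
  \<^const>\<open>len\<close> is a uniform limit of continuous functions.\<close>

lemma continuous_len: "continuous_on {a..b} len"
proof -
  have "\<exists>f. continuous_on {a..b} f \<and> (\<forall>x\<in>{a..b}. \<bar>f x - len x\<bar> \<le> e)" if "0 < e" for e :: real
  proof -
    have "\<exists>n t. t ` {..n} \<subseteq> {a..b} \<and> (\<forall>i<n. t i \<le> t (Suc i)) \<and>
        len b - e \<le> (\<Sum>i<n. dist (\<gamma> (t i)) (\<gamma> (t (Suc i))))"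
    proof (rule ccontr)
      assume H: "\<not> ?thesis"
      have "path_length \<gamma> a b \<le> ennreal (len b - e)"
      proof (rule path_length_least)
        fix n :: nat and t :: "nat \<Rightarrow> real" assume "t ` {..n} \<subseteq> {a..b}" "\<And>i. i < n \<Longrightarrow> t i \<le> t (Suc i)"
        with H have "\<not> len b - e \<le> (\<Sum>i<n. dist (\<gamma> (t i)) (\<gamma> (t (Suc i))))"
          by blast
        then show "ennreal (\<Sum>i<n. dist (\<gamma> (t i)) (\<gamma> (t (Suc i)))) \<le> ennreal (len b - e)"
          by (intro ennreal_leI) auto
      qed
      moreover have "len b - e \<ge> 0"
      proof (rule ccontr)
        assume "\<not> len b - e \<ge> 0"
        then have "(\<lambda>_. a) ` {..0::nat} \<subseteq> {a..b} \<and> (\<forall>i<0::nat. a \<le> a) \<and>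
            len b - e \<le> (\<Sum>i<0::nat. dist (\<gamma> a) (\<gamma> a))"
          using a_le_b by auto
        with H show False by blast
      qed
      ultimately show False
        using path_length_eq_len[of b] a_le_b \<open>0 < e\<close> by (simp add: ennreal_le_iff2)
    qed
    then obtain n t where t: "t ` {..n} \<subseteq> {a..b}" "\<And>i. i < n \<Longrightarrow> t i \<le> t (Suc i)"
      and approx: "len b - e \<le> (\<Sum>i<n. dist (\<gamma> (t i)) (\<gamma> (t (Suc i))))"
      by blast
    define f where "f x = (\<Sum>i<n. dist (\<gamma> (min (t i) x)) (\<gamma> (min (t (Suc i)) x)))" for x
    have t_in: "t i \<in> {a..b}" if "i \<le> n" for i
      using t(1) that by auto
    have "continuous_on {a..b} (\<lambda>x. \<gamma> (min (t i) x))" if "i \<le> n" for i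
      using t_in[OF that]
      by (intro continuous_on_compose2[OF continuous]) (auto intro!: continuous_intros)
    then have "continuous_on {a..b} f"
      unfolding f_def by (intro continuous_intros) auto
    moreover have "\<bar>f x - len x\<bar> \<le> e" if x: "x \<in> {a..b}" for x
    proof -
      have "f x \<le> len x"
        using path_length_lower_part[of t n a b x \<gamma>, OF t] path_length_eq_len[of x] x
        by (simp add: f_def ennreal_le_iff)
      moreover have "(\<Sum>i<n. dist (\<gamma> (max (t i) x)) (\<gamma> (max (t (Suc i)) x))) \<le> len b - len x"
        using path_length_upper_part[of t n a b x \<gamma>, OF t] path_length_sub[of x b] x
        by (simp add: ennreal_le_iff)
      ultimately show ?thesis
        using variation_cut_le[of n t \<gamma> x, OF t(2)] approx by (simp add: f_def)
    qed
    ultimately show ?thesis by blast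
  qed
  then obtain f where f: "\<And>e. 0 < e \<Longrightarrow> continuous_on {a..b} (f e)"
      "\<And>e x. 0 < e \<Longrightarrow> x \<in> {a..b} \<Longrightarrow> \<bar>f e x - len x\<bar> \<le> e"
    by metis
  have "uniform_limit {a..b} (\<lambda>n. f (1 / real (Suc n))) len sequentially"
  proof (rule uniform_limitI)
    fix e :: real assume "0 < e"
    then have "\<forall>\<^sub>F n in sequentially. 1 / real (Suc n) < e"
      using order_tendstoD(2)[OF LIMSEQ_inverse_real_of_nat, of e] by (simp add: inverse_eq_divide)
    then show "\<forall>\<^sub>F n in sequentially. \<forall>x\<in>{a..b}. dist (f (1 / real (Suc n)) x) (len x) < e"
    proof eventually_elim
      case (elim n)
      show ?case
      proof
        fix x assume "x \<in> {a..b}"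
        with f(2)[of "1 / real (Suc n)" x] elim show "dist (f (1 / real (Suc n)) x) (len x) < e"
          by (auto simp: dist_real_def)
      qed
    qed
  qed
  then show ?thesis
    using f(1) by (intro uniform_limit_theorem[where F = sequentially and f = "\<lambda>n. f (1 / real (Suc n))"]) auto
qed

lemma len_attained:
  assumes "0 \<le> s" "s \<le> len b"
  obtains x where "x \<in> {a..b}" "len x = s"
  using IVT'[of len a s b] assms a_le_b continuous_len by auto

lemma arclength_param_len:
  assumes "x \<in> {a..b}"
  shows "\<alpha> (len x) = \<gamma> x"
proof -
  define t where "t = (SOME t. t \<in> {a..b} \<and> path_length \<gamma> a t = ennreal (len x))"
  have "\<exists>t. t \<in> {a..b} \<and> path_length \<gamma> a t = ennreal (len x)"
    using assms path_length_eq_len[of x] by auto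
  from someI_ex[OF this] have t: "t \<in> {a..b}" and "path_length \<gamma> a t = ennreal (len x)"
    unfolding t_def[symmetric] by blast+
  then have len: "len t = len x"
    unfolding len_def[of t] by simp
  have "dist (\<gamma> t) (\<gamma> x) \<le> 0"
  proof (cases "t \<le> x")
    case True
    then show ?thesis using dist_le_len[of t x] len t assms by auto
  next
    case False
    then show ?thesis using dist_le_len[of x t] len t assms by (auto simp: dist_commute)
  qed
  then have "\<gamma> t = \<gamma> x" by simp
  then show ?thesis unfolding arclength_param_def t_def by simp
qed

lemma continuous_arclength_param: "continuous_on {0..len b} \<alpha>"
proof -
  have "dist (\<alpha> s) (\<alpha> t) \<le> \<bar>s - t\<bar>" if st: "s \<in> {0..len b}" "t \<in> {0..len b}" for s t
  proof -
    obtain x where x: "x \<in> {a..b}" "len x = s"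
      using st len_attained[of s] by auto
    obtain y where y: "y \<in> {a..b}" "len y = t"
      using st len_attained[of t] by auto
    have "dist (\<gamma> x) (\<gamma> y) \<le> \<bar>len x - len y\<bar>"
      using dist_le_len[of x y] dist_le_len[of y x] x y
      by (cases "x \<le> y") (simp_all add: dist_commute)
    then show ?thesis
      unfolding x(2)[symmetric] y(2)[symmetric] arclength_param_len[OF x(1)] arclength_param_len[OF y(1)] .
  qed
  then have "1-lipschitz_on {0..len b} \<alpha>"
    by (intro lipschitz_onI) (auto simp: dist_real_def)
  then show ?thesis
    by (rule lipschitz_on_continuous_on)
qed

lemma subpath:
  assumes "a \<le> s" "s \<le> t" "t \<le> b"
  shows "rectifiable_path \<gamma> s t"
proof
  show "path_length \<gamma> s t < \<infinity>" using path_length_sub[OF assms] by simp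
  show "continuous_on {s..t} \<gamma>" using assms by (auto intro: continuous_on_subset[OF continuous])
qed (use assms in auto)

text \<open>The arc length parametrization of a subpath is a translate of the one of the whole path.\<close>

lemma path_integral_subpath:
  assumes st: "a \<le> s" "s \<le> t" "t \<le> b"
  shows "path_integral (s, t, \<gamma>) g = (\<integral>\<^sup>+r\<in>{len s..len t}. g (\<alpha> r) \<partial>lebesgue)"
proof -
  interpret sub: rectifiable_path \<gamma> s t by (rule subpath[OF st])
  have sub_len: "sub.len x = len x - len s" if "x \<in> {s..t}" for x
    using path_length_sub[of s x] that st by (simp add: sub.len_def)
  have param: "sub.\<alpha> r = \<alpha> (len s + r)" if "r \<in> {0..len t - len s}" for r
  proof -
    obtain x where x: "x \<in> {s..t}" "sub.len x = r"
      using sub.len_attained[of r] \<open>r \<in> _\<close> sub_len[of t] st by auto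
    then show ?thesis
      using sub.arclength_param_len[of x] arclength_param_len[of x] sub_len[of x] st by auto
  qed
  have "path_integral (s, t, \<gamma>) g = (\<integral>\<^sup>+r\<in>{0..len t - len s}. g (sub.\<alpha> r) \<partial>lebesgue)"
    using path_length_sub[OF st] by (simp add: path_integral_def)
  also have "\<dots> = (\<integral>\<^sup>+r. g (\<alpha> (len s + 1 * r)) * indicator {len s..len t} (len s + 1 * r) \<partial>lebesgue)"
    by (intro nn_integral_cong) (auto simp: param split: split_indicator)
  also have "\<dots> = (\<integral>\<^sup>+r\<in>{len s..len t}. g (\<alpha> r) \<partial>lebesgue)"
    by (rule nn_integral_lebesgue_isometry) simp
  finally show ?thesis .
qed

lemma path_integral_eq: "path_integral (a, b, \<gamma>) g = (\<integral>\<^sup>+r\<in>{0..len b}. g (\<alpha> r) \<partial>lebesgue)"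
  using path_integral_subpath[of a b g] a_le_b by simp

lemma path_integral_subpath_le:
  assumes "a \<le> s" "s \<le> t" "t \<le> b"
  shows "path_integral (s, t, \<gamma>) g \<le> path_integral (a, b, \<gamma>) g"
proof -
  have "r \<in> {len s..len t} \<Longrightarrow> r \<in> {0..len b}" for r
    using path_length_sub(2)[of t b] len_nonneg[of s] assms
    by (auto simp del: len_nonneg)
  then show ?thesis
    unfolding path_integral_subpath[OF assms] path_integral_eq
    by (intro nn_integral_mono mult_left_mono) (simp_all add: indicator_def)
qed

end


section \<open>Truncation on an interval\<close>

definition truncation :: "real \<Rightarrow> real \<Rightarrow> real \<Rightarrow> real"
  where "truncation A B x = max A (min B x)"

text \<open>Continuity from above, along the intervals \<open>(s, s + 1/n]\<close>, of the measure with density \<open>H\<close>.\<close>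

lemma small_initial_integral:
  fixes H :: "real \<Rightarrow> ennreal"
  assumes H: "H \<in> borel_measurable lebesgue" and fin: "(\<integral>\<^sup>+x\<in>{s..b}. H x \<partial>lebesgue) < \<infinity>" and e: "0 < e"
  obtains d where "0 < d" "\<And>r. s < r \<Longrightarrow> r < s + d \<Longrightarrow> r \<le> b \<Longrightarrow> (\<integral>\<^sup>+x\<in>{s<..r}. H x \<partial>lebesgue) < e"
proof -
  define M where "M = density lebesgue (\<lambda>x. H x * indicator {s..b} x)"
  define A where "A n = {s<..min b (s + 1 / real (Suc n))}" for n
  have M: "emeasure M S = (\<integral>\<^sup>+x\<in>S. H x * indicator {s..b} x \<partial>lebesgue)" if "S \<in> sets lebesgue" for S
    unfolding M_def using that H
    by (intro emeasure_density borel_measurable_times_ennreal borel_measurable_indicator) auto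
  have sets: "range A \<subseteq> sets M"
    by (auto simp: A_def M_def)
  have "1 / real (Suc n) \<le> 1 / real (Suc m)" if "m \<le> n" for m n
    using that by (intro divide_left_mono) auto
  then have "decseq A"
    unfolding A_def decseq_def by fastforce
  moreover have "emeasure M (A n) \<noteq> \<infinity>" for n
  proof -
    have "emeasure M (A n) \<le> (\<integral>\<^sup>+x\<in>{s..b}. H x \<partial>lebesgue)"
      by (subst M) (auto simp: A_def intro!: nn_integral_mono split: split_indicator)
    with fin show ?thesis by (auto simp: top_unique)
  qed
  ultimately have "(\<lambda>n. emeasure M (A n)) \<longlonglongrightarrow> emeasure M (\<Inter>n. A n)"
    using sets by (intro Lim_emeasure_decseq) auto
  also have "(\<Inter>n. A n) = {}"
  proof (rule ccontr)
    assume "(\<Inter>n. A n) \<noteq> {}"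
    then obtain x where x: "\<And>n. x \<in> A n" by auto
    then have "0 < x - s" by (auto simp: A_def)
    then obtain n where "inverse (real (Suc n)) < x - s"
      using reals_Archimedean by blast
    with x[of n] show False by (simp add: A_def inverse_eq_divide)
  qed
  finally have "(\<lambda>n. emeasure M (A n)) \<longlonglongrightarrow> 0" by simp
  then have "\<forall>\<^sub>F n in sequentially. emeasure M (A n) < e"
    using e by (rule order_tendstoD)
  then obtain n where n: "emeasure M (A n) < e"
    by (auto simp: eventually_sequentially)
  have "(\<integral>\<^sup>+x\<in>{s<..r}. H x \<partial>lebesgue) < e" if "s < r" "r < s + 1 / real (Suc n)" "r \<le> b" for r
  proof -
    have "(\<integral>\<^sup>+x\<in>{s<..r}. H x \<partial>lebesgue) \<le> emeasure M (A n)"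
      using that by (subst M) (auto simp: A_def intro!: nn_integral_mono split: split_indicator)
    with n show ?thesis by simp
  qed
  then show thesis by (intro that[of "1 / real (Suc n)"]) auto
qed

lemma AE_lebesgue_neq: "AE x in lebesgue. x \<noteq> (c::real)"
  by (rule AE_I'[of "{c}"]) auto

text \<open>Take the last time \<open>s\<close> at which \<open>w\<close> is at most its truncated initial value and the first
  later time \<open>t\<close> at which \<open>w\<close> reaches its truncated final value.  In between, \<open>w\<close> runs strictly
  inside the strip, so there the integral of \<open>G\<close> is not affected by the restriction to the strip.
  The function \<open>w\<close> may jump at the boundary of \<open>U\<close>; that it cannot jump upwards at \<open>s\<close>
  follows from integrability of \<open>G\<close> on \<open>U\<close>.\<close>

lemma truncated_increase_le:
  fixes w :: "real \<Rightarrow> real" and G H :: "real \<Rightarrow> ennreal"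
  assumes ab: "a \<le> b" and U: "open U" "continuous_on U w" "\<And>x. x \<notin> U \<Longrightarrow> w x = 0"
    and G: "\<And>s t. a \<le> s \<Longrightarrow> s < t \<Longrightarrow> t \<le> b \<Longrightarrow> ennreal \<bar>w s - w t\<bar> \<le> (\<integral>\<^sup>+x\<in>{s..t}. G x \<partial>lebesgue)"
    and H: "H \<in> borel_measurable lebesgue" "\<And>x. x \<in> U \<Longrightarrow> G x \<le> H x"
      "(\<integral>\<^sup>+x\<in>{a..b}. H x \<partial>lebesgue) < \<infinity>"
    and AB: "0 \<le> A" "A < B"
  shows "ennreal (truncation A B (w b) - truncation A B (w a))
    \<le> (\<integral>\<^sup>+x\<in>{a..b}. G x * indicator {A<..<B} (w x) \<partial>lebesgue)"
proof (cases "truncation A B (w a) < truncation A B (w b)")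
  case False
  then show ?thesis by (simp add: ennreal_neg)
next
  case True
  define A' B' where "A' = truncation A B (w a)" and "B' = truncation A B (w b)"
  have AB': "A \<le> A'" "A' < B'" "B' \<le> B" "w a \<le> A'" "B' \<le> w b"
    using True AB by (auto simp: A'_def B'_def truncation_def max_def min_def split: if_splits)
  have open_super: "open {x. c < w x}" if "0 \<le> c" for c
  proof -
    have "x \<in> U" if "c < w x" for x
      using U(3)[of x] that \<open>0 \<le> c\<close> by (cases "x \<in> U") auto
    then have "{x. c < w x} = U \<inter> w -` {c<..}" by auto
    then show ?thesis using continuous_open_preimage[OF U(2,1)] by simp
  qed
  have "compact ({a..b} - {x. A' < w x})"
    using AB AB' by (intro compact_diff open_super) auto
  moreover have "a \<in> {a..b} - {x. A' < w x}" using ab AB' by auto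
  ultimately obtain s where "s \<in> {a..b} - {x. A' < w x}"
      and max: "\<forall>x\<in>{a..b} - {x. A' < w x}. x \<le> s"
    using compact_attains_sup[of "{a..b} - {x. A' < w x}"] by blast
  then have s: "s \<in> {a..b}" "w s \<le> A'" by auto
  have sb: "s < b" using s AB'(2,5) by (cases "s = b") auto
  have above: "A' < w x" if "s < x" "x \<le> b" for x
  proof -
    have "x \<in> {a..b}" "\<not> x \<le> s" using that s(1) by auto
    then show ?thesis using max by blast
  qed
  have inU: "x \<in> U" if "s < x" "x \<le> b" for x
    using above[OF that] U(3)[of x] AB(1) AB'(1) by (cases "x \<in> U") auto
  have "(\<integral>\<^sup>+x\<in>{s..b}. H x \<partial>lebesgue) < \<infinity>"
    using s(1) by (intro le_less_trans[OF _ H(3)] nn_integral_mono) (auto split: split_indicator)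
  then obtain d where d: "0 < d"
      "\<And>r. s < r \<Longrightarrow> r < s + d \<Longrightarrow> r \<le> b \<Longrightarrow> (\<integral>\<^sup>+x\<in>{s<..r}. H x \<partial>lebesgue) < ennreal (B' - A')"
    using small_initial_integral[OF H(1), of s b "ennreal (B' - A')"] AB' by auto
  have near: "w r < B'" if "s < r" "r < s + d" "r \<le> b" for r
  proof -
    have "ennreal (w r - w s) \<le> ennreal \<bar>w s - w r\<bar>" by (intro ennreal_leI) auto
    also have "\<dots> \<le> (\<integral>\<^sup>+x\<in>{s..r}. G x \<partial>lebesgue)" using s that by (intro G) auto
    also have "\<dots> \<le> (\<integral>\<^sup>+x\<in>{s<..r}. H x \<partial>lebesgue)"
      using AE_lebesgue_neq[of s] that inU H(2)
      by (intro nn_integral_mono_AE) (auto elim!: eventually_mono split: split_indicator)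
    also have "\<dots> < ennreal (B' - A')" by (rule d(2)[OF that])
    finally have "w r - w s < B' - A'" using above[of r] s(2) that by (simp add: ennreal_less_iff)
    with s(2) show ?thesis by simp
  qed
  define c where "c = min b (s + d / 2)"
  have c: "s < c" "c \<le> b" "c < s + d" using sb d(1) by (auto simp: c_def)
  have "compact ({c..b} - (U \<inter> w -` {..<B'}))"
    by (intro compact_diff continuous_open_preimage[OF U(2,1)]) auto
  moreover have "b \<in> {c..b} - (U \<inter> w -` {..<B'})" using AB' c by auto
  ultimately obtain t where t: "t \<in> {c..b} - (U \<inter> w -` {..<B'})"
      and min: "\<forall>x\<in>{c..b} - (U \<inter> w -` {..<B'}). t \<le> x"
    using compact_attains_inf[of "{c..b} - (U \<inter> w -` {..<B'})"] by blast
  have st: "s < t" "t \<le> b" "B' \<le> w t"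
    using t c inU[of t] by auto
  have below: "w x < B'" if "s < x" "x < t" for x
  proof (cases "x < c")
    case True
    then show ?thesis using near[of x] that c by auto
  next
    case False
    then have "x \<in> {c..b}" using that st by auto
    moreover have "\<not> t \<le> x" using that by simp
    ultimately show ?thesis using min by blast
  qed
  have "ennreal (B' - A') \<le> ennreal \<bar>w s - w t\<bar>"
    using s(2) st by (intro ennreal_leI) auto
  also have "\<dots> \<le> (\<integral>\<^sup>+x\<in>{s..t}. G x \<partial>lebesgue)"
    using s st by (intro G) auto
  also have "\<dots> \<le> (\<integral>\<^sup>+x\<in>{a..b}. G x * indicator {A<..<B} (w x) \<partial>lebesgue)"
  proof (rule nn_integral_mono_AE)
    show "AE x in lebesgue. G x * indicator {s..t} x \<le> G x * indicator {A<..<B} (w x) * indicator {a..b} x"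
      using AE_lebesgue_neq[of s] AE_lebesgue_neq[of t]
    proof eventually_elim
      case (elim x)
      show ?case
      proof (cases "x \<in> {s..t}")
        case True
        with elim above[of x] below[of x] s(1) st AB' show ?thesis by auto
      qed auto
    qed
  qed
  finally show ?thesis by (simp add: A'_def B'_def)
qed

text \<open>A decrease becomes an increase when the parameter is reversed.\<close>

lemma truncated_difference_le:
  fixes w :: "real \<Rightarrow> real" and G H :: "real \<Rightarrow> ennreal"
  assumes ab: "a \<le> b" and U: "open U" "continuous_on U w" "\<And>x. x \<notin> U \<Longrightarrow> w x = 0"
    and G: "\<And>s t. a \<le> s \<Longrightarrow> s < t \<Longrightarrow> t \<le> b \<Longrightarrow> ennreal \<bar>w s - w t\<bar> \<le> (\<integral>\<^sup>+x\<in>{s..t}. G x \<partial>lebesgue)"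
    and H: "H \<in> borel_measurable lebesgue" "\<And>x. x \<in> U \<Longrightarrow> G x \<le> H x"
      "(\<integral>\<^sup>+x\<in>{a..b}. H x \<partial>lebesgue) < \<infinity>"
    and AB: "0 \<le> A" "A < B"
  shows "ennreal \<bar>truncation A B (w a) - truncation A B (w b)\<bar>
    \<le> (\<integral>\<^sup>+x\<in>{a..b}. G x * indicator {A<..<B} (w x) \<partial>lebesgue)"
proof (cases "truncation A B (w a) \<le> truncation A B (w b)")
  case True
  then show ?thesis
    using truncated_increase_le[OF assms] by (simp add: abs_if)
next
  case False
  have reflect: "(\<integral>\<^sup>+x\<in>{- t..- s}. F (- x) \<partial>lebesgue) = (\<integral>\<^sup>+x\<in>{s..t}. F x \<partial>lebesgue)"
    for F :: "real \<Rightarrow> ennreal" and s t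
  proof -
    have "(\<integral>\<^sup>+x\<in>{- t..- s}. F (- x) \<partial>lebesgue)
        = (\<integral>\<^sup>+x. F (0 + (- 1) * x) * indicator {s..t} (0 + (- 1) * x) \<partial>lebesgue)"
      by (intro nn_integral_cong) (auto split: split_indicator)
    also have "\<dots> = (\<integral>\<^sup>+x\<in>{s..t}. F x \<partial>lebesgue)"
      by (rule nn_integral_lebesgue_isometry) simp
    finally show ?thesis .
  qed
  have "ennreal (truncation A B (w (- (- a))) - truncation A B (w (- (- b))))
    \<le> (\<integral>\<^sup>+x\<in>{- b..- a}. G (- x) * indicator {A<..<B} (w (- x)) \<partial>lebesgue)"
  proof (rule truncated_increase_le[where U = "uminus -` U" and H = "\<lambda>x. H (- x)"])
    show "open (uminus -` U)"
      using U(1) by (intro open_vimage) (auto intro!: continuous_intros)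
    show "continuous_on (uminus -` U) (\<lambda>x. w (- x))"
      by (rule continuous_on_compose2[OF U(2)]) (auto intro!: continuous_intros)
    show "(\<lambda>x. H (- x)) \<in> borel_measurable lebesgue"
      using measurable_compose[OF lebesgue_measurable_scaling[of "- 1"] H(1)] by simp
    show "(\<integral>\<^sup>+x\<in>{- b..- a}. H (- x) \<partial>lebesgue) < \<infinity>"
      using H(3) by (simp only: reflect)
    fix s t :: real assume st: "- b \<le> s" "s < t" "t \<le> - a"
    show "ennreal \<bar>w (- s) - w (- t)\<bar> \<le> (\<integral>\<^sup>+x\<in>{s..t}. G (- x) \<partial>lebesgue)"
      using G[of "- t" "- s"] reflect[where F = G and s = "- t" and t = "- s"] st by (simp add: abs_minus_commute)
  qed (use ab U(3) H(2) AB in auto)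
  then show ?thesis
    using False reflect[where F = "\<lambda>x. G x * indicator {A<..<B} (w x)" and s = a and t = b] by (simp add: abs_if)
qed


section \<open>Borel regular outer measures and exceptional path families\<close>

locale borel_regular =
  fixes \<mu> :: "'a::metric_space set \<Rightarrow> ennreal"
  assumes regular: "borel_regular_outer_measure \<mu>"
begin

abbreviation M :: "'a measure"
  where "M \<equiv> om_measure \<mu>"

lemma outer: "outer_measure_space (Pow UNIV) \<mu>"
  using regular by (simp add: borel_regular_outer_measure_def)

lemma space_M [simp]: "space M = UNIV"
  by (rule space_om_measure[OF outer])

lemma sets_M_borel: "A \<in> sets borel \<Longrightarrow> A \<in> sets M"
  using regular sets_om_measure[OF outer] by (auto simp: borel_regular_outer_measure_def)

lemma emeasure_M: "A \<in> sets M \<Longrightarrow> emeasure M A = \<mu> A"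
  using emeasure_om_measure[OF outer] sets_om_measure[OF outer] by simp

lemma outer_mono: "A \<subseteq> B \<Longrightarrow> \<mu> A \<le> \<mu> B"
  using outer by (auto simp: outer_measure_space_def increasing_def)

lemma borel_measurable_M: "f \<in> borel_measurable borel \<Longrightarrow> f \<in> borel_measurable M"
  by (auto simp: measurable_def intro: sets_M_borel)

text \<open>Sets have Borel hulls of the same measure by regularity.  Majorants of an increasing sequence
  need not increase, so for the supremum one takes the lower limit of the majorants and controls
  its integral by Fatou's lemma.\<close>

lemma borel_majorant:
  assumes "f \<in> borel_measurable M"
  shows "\<exists>F\<in>borel_measurable borel. (\<forall>x. f x \<le> F x) \<and> (\<integral>\<^sup>+x. F x \<partial>M) \<le> (\<integral>\<^sup>+x. f x \<partial>M)"
  using assms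
proof (induction rule: borel_measurable_induct)
  case (cong f g)
  then have "f = g" by auto
  with cong show ?case by simp
next
  case (set A)
  obtain B where B: "B \<in> sets borel" "A \<subseteq> B" "\<mu> B = \<mu> A"
    using regular unfolding borel_regular_outer_measure_def by blast
  have "indicator B \<in> borel_measurable borel" using B by simp
  moreover have "indicator A x \<le> (indicator B x :: ennreal)" for x
    using B(2) by (auto split: split_indicator)
  moreover have "(\<integral>\<^sup>+x. indicator B x \<partial>M) \<le> (\<integral>\<^sup>+x. indicator A x \<partial>M)"
    using B set sets_M_borel by (simp add: emeasure_M)
  ultimately show ?case by (intro bexI[of _ "indicator B"]) auto
next
  case (mult f c)
  then obtain F where F: "F \<in> borel_measurable borel" "\<And>x. f x \<le> F x"
      "(\<integral>\<^sup>+x. F x \<partial>M) \<le> (\<integral>\<^sup>+x. f x \<partial>M)" by blast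
  have "(\<lambda>x. c * F x) \<in> borel_measurable borel" using F(1) by simp
  moreover have "c * f x \<le> c * F x" for x using F(2) by (intro mult_left_mono) auto
  moreover have "(\<integral>\<^sup>+x. c * F x \<partial>M) \<le> (\<integral>\<^sup>+x. c * f x \<partial>M)"
    using F mult(2) by (simp add: nn_integral_cmult borel_measurable_M mult_left_mono)
  ultimately show ?case by (intro bexI[of _ "\<lambda>x. c * F x"]) auto
next
  case (add f g)
  then obtain F G where F: "F \<in> borel_measurable borel" "\<And>x. f x \<le> F x"
      "(\<integral>\<^sup>+x. F x \<partial>M) \<le> (\<integral>\<^sup>+x. f x \<partial>M)"
    and G: "G \<in> borel_measurable borel" "\<And>x. g x \<le> G x"
      "(\<integral>\<^sup>+x. G x \<partial>M) \<le> (\<integral>\<^sup>+x. g x \<partial>M)" by blast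
  have "(\<lambda>x. G x + F x) \<in> borel_measurable borel" using F(1) G(1) by simp
  moreover have "g x + f x \<le> G x + F x" for x using F(2) G(2) by (intro add_mono) auto
  moreover have "(\<integral>\<^sup>+x. G x + F x \<partial>M) \<le> (\<integral>\<^sup>+x. g x + f x \<partial>M)"
    using F G add by (simp add: nn_integral_add borel_measurable_M add_mono)
  ultimately show ?case by (intro bexI[of _ "\<lambda>x. G x + F x"]) auto
next
  case (seq U)
  then obtain F where F: "\<And>i. F i \<in> borel_measurable borel" "\<And>i x. U i x \<le> F i x"
      "\<And>i. (\<integral>\<^sup>+x. F i x \<partial>M) \<le> (\<integral>\<^sup>+x. U i x \<partial>M)" by metis
  have "(\<lambda>x. liminf (\<lambda>i. F i x)) \<in> borel_measurable borel"
    using F(1) by measurable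
  moreover have "(SUP i. U i) x \<le> liminf (\<lambda>i. F i x)" for x
    unfolding SUP_apply
  proof (rule SUP_least)
    fix i
    have "U i x \<le> F j x" if "i \<le> j" for j
      using incseqD[OF \<open>incseq U\<close> that] F(2)[of j x] by (auto simp: le_fun_def intro: order_trans)
    then show "U i x \<le> liminf (\<lambda>i. F i x)"
      by (intro Liminf_bounded) (auto simp: eventually_sequentially)
  qed
  moreover have "(\<integral>\<^sup>+x. liminf (\<lambda>i. F i x) \<partial>M) \<le> (\<integral>\<^sup>+x. (SUP i. U i) x \<partial>M)"
  proof -
    have "(\<integral>\<^sup>+x. liminf (\<lambda>i. F i x) \<partial>M) \<le> liminf (\<lambda>i. \<integral>\<^sup>+x. F i x \<partial>M)"
      using F(1) by (intro nn_integral_liminf borel_measurable_M)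
    also have "\<dots> \<le> liminf (\<lambda>i::nat. \<integral>\<^sup>+x. (SUP i. U i) x \<partial>M)"
    proof (intro Liminf_mono always_eventually allI)
      fix i
      show "(\<integral>\<^sup>+x. F i x \<partial>M) \<le> (\<integral>\<^sup>+x. (SUP i. U i) x \<partial>M)"
        by (rule order_trans[OF F(3)]) (auto intro!: nn_integral_mono SUP_upper simp: SUP_apply)
    qed
    finally show ?thesis by (simp add: Liminf_const)
  qed
  ultimately show ?case by (intro bexI[of _ "\<lambda>x. liminf (\<lambda>i. F i x)"]) auto
qed

text \<open>An upper gradient is only \<open>\<mu>\<close>-measurable, whereas a weight that witnesses that a path family is
  exceptional has to be Borel; the majorant bridges this gap.\<close>

lemma borel_majorant_Lp:
  assumes f: "f \<in> borel_measurable M" "(\<integral>\<^sup>+x. f x epowr p \<partial>M) < \<infinity>" and p: "0 < p"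
  obtains F where "F \<in> borel_measurable borel" "\<And>x. f x \<le> F x" "(\<integral>\<^sup>+x. F x epowr p \<partial>M) < \<infinity>"
proof -
  have "(\<lambda>x. f x epowr p) \<in> borel_measurable M" using f by measurable
  from borel_majorant[OF this] obtain F where F: "F \<in> borel_measurable borel" "\<And>x. f x epowr p \<le> F x"
      "(\<integral>\<^sup>+x. F x \<partial>M) \<le> (\<integral>\<^sup>+x. f x epowr p \<partial>M)" by blast
  show thesis
  proof (rule that[of "\<lambda>x. F x epowr (1 / p)"])
    show "(\<lambda>x. F x epowr (1 / p)) \<in> borel_measurable borel" using F by measurable
    show "f x \<le> F x epowr (1 / p)" for x using F(2) p by (simp add: epowr_le_iff)
    show "(\<integral>\<^sup>+x. (F x epowr (1 / p)) epowr p \<partial>M) < \<infinity>"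
      using F(3) f(2) p by (auto simp: epowr_epowr)
  qed
qed

lemma almost_every_path_mono:
  assumes "almost_every_path \<mu> p P" "\<And>c. c \<in> rect_paths \<Longrightarrow> P c \<Longrightarrow> Q c"
  shows "almost_every_path \<mu> p Q"
proof -
  have "{c \<in> rect_paths. \<not> Q c} \<subseteq> {c \<in> rect_paths. \<not> P c}" using assms(2) by blast
  with assms(1) show ?thesis
    unfolding almost_every_path_def zero_modulus_def by (meson subsetD)
qed

text \<open>The maximum of the two weights is infinite along every path that is exceptional for one of them, and
  its \<open>p\<close>-th power is at most the sum of the \<open>p\<close>-th powers.\<close>

lemma almost_every_path_conj:
  assumes "almost_every_path \<mu> p P" "almost_every_path \<mu> p Q"
  shows "almost_every_path \<mu> p (\<lambda>c. P c \<and> Q c)"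
proof -
  obtain f g where f: "f \<in> borel_measurable borel" "(\<integral>\<^sup>+x. f x epowr p \<partial>M) < \<infinity>"
      "\<And>c. c \<in> rect_paths \<Longrightarrow> \<not> P c \<Longrightarrow> path_integral c f = \<infinity>"
    and g: "g \<in> borel_measurable borel" "(\<integral>\<^sup>+x. g x epowr p \<partial>M) < \<infinity>"
      "\<And>c. c \<in> rect_paths \<Longrightarrow> \<not> Q c \<Longrightarrow> path_integral c g = \<infinity>"
    using assms by (auto simp: almost_every_path_def zero_modulus_def)
  define h where "h x = max (f x) (g x)" for x
  have h: "h \<in> borel_measurable borel" using f g unfolding h_def by measurable
  have "(\<integral>\<^sup>+x. h x epowr p \<partial>M) \<le> (\<integral>\<^sup>+x. f x epowr p + g x epowr p \<partial>M)"
    unfolding h_def by (intro nn_integral_mono epowr_max_le)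
  also have "\<dots> = (\<integral>\<^sup>+x. f x epowr p \<partial>M) + (\<integral>\<^sup>+x. g x epowr p \<partial>M)"
    using f(1) g(1) by (intro nn_integral_add borel_measurable_M borel_measurable_epowr)
  also have "\<dots> < \<infinity>" using f g by (simp add: ennreal_add_less_top)
  finally have fin: "(\<integral>\<^sup>+x. h x epowr p \<partial>M) < \<infinity>" .
  have le: "path_integral c f \<le> path_integral c h" "path_integral c g \<le> path_integral c h" for c
    unfolding path_integral_def by (auto simp: h_def split: prod.split intro!: nn_integral_mono mult_right_mono)
  have "path_integral c h = \<infinity>" if "c \<in> rect_paths" "\<not> (P c \<and> Q c)" for c
    using le[of c] f(3)[OF that(1)] g(3)[OF that(1)] that(2) by (auto simp: top_unique)
  with h fin show ?thesis
    unfolding almost_every_path_def zero_modulus_def by (intro bexI[of _ h]) auto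
qed

lemma almost_every_path_finite_integral:
  assumes "F \<in> borel_measurable borel" "(\<integral>\<^sup>+x. F x epowr p \<partial>M) < \<infinity>"
  shows "almost_every_path \<mu> p (\<lambda>c. path_integral c F < \<infinity>)"
  unfolding almost_every_path_def zero_modulus_def using assms
  by (intro bexI[of _ F]) (auto simp: less_top[symmetric])

text \<open>A path that contains an exceptional subpath is exceptional for the same weight.\<close>

lemma almost_every_path_subpaths:
  assumes "almost_every_path \<mu> p P"
  shows "almost_every_path \<mu> p (\<lambda>(a, b, \<gamma>). \<forall>s t. a \<le> s \<longrightarrow> s \<le> t \<longrightarrow> t \<le> b \<longrightarrow>
    (s, t, \<gamma>) \<in> rect_paths \<longrightarrow> P (s, t, \<gamma>))"
proof -
  obtain f where f: "f \<in> borel_measurable borel" "(\<integral>\<^sup>+x. f x epowr p \<partial>M) < \<infinity>"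
      "\<And>c. c \<in> rect_paths \<Longrightarrow> \<not> P c \<Longrightarrow> path_integral c f = \<infinity>"
    using assms by (auto simp: almost_every_path_def zero_modulus_def)
  have "path_integral (a, b, \<gamma>) f = \<infinity>"
    if "(a, b, \<gamma>) \<in> rect_paths" "a \<le> s" "s \<le> t" "t \<le> b" "(s, t, \<gamma>) \<in> rect_paths" "\<not> P (s, t, \<gamma>)"
    for a b s t \<gamma>
  proof -
    interpret rectifiable_path \<gamma> a b
      using that(1) by unfold_locales (auto simp: rect_paths_def)
    show ?thesis
      using path_integral_subpath_le[of s t f] f(3)[OF that(5,6)] that by (simp add: top_unique)
  qed
  with f show ?thesis
    unfolding almost_every_path_def zero_modulus_def by (intro bexI[of _ f]) auto
qed


section \<open>Weak upper gradients of truncations\<close>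

lemma weak_upper_gradient_real:
  "weak_upper_gradient \<mu> p (\<lambda>x. ereal (u x)) g \<longleftrightarrow> g \<in> borel_measurable M \<and>
    almost_every_path \<mu> p (\<lambda>(a, b, \<gamma>). ennreal \<bar>u (\<gamma> a) - u (\<gamma> b)\<bar> \<le> path_integral (a, b, \<gamma>) g)"
  by (simp add: weak_upper_gradient_def)

text \<open>The capacities measure the energy on \<open>\<Omega>\<close>; off \<open>\<Omega>\<close> the gradient may be infinite, and at the boundary
  \<open>u\<close> may be discontinuous.  A Borel majorant of
  \<open>g\<close> on \<open>\<Omega>\<close> has finite integral along almost every path, and along such a path all of whose subpaths
  obey the upper gradient inequality the one-dimensional estimate applies to \<open>u\<close> in arc length
  parametrization.\<close>

lemma weak_upper_gradient_truncation:
  assumes p: "0 < p" and \<Omega>: "open \<Omega>" and u: "continuous_on \<Omega> u" "\<And>x. x \<notin> \<Omega> \<Longrightarrow> u x = 0"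
    and g: "weak_upper_gradient \<mu> p (\<lambda>x. ereal (u x)) g" "(\<integral>\<^sup>+x\<in>\<Omega>. g x epowr p \<partial>M) < \<infinity>"
    and AB: "0 \<le> A" "A < B"
  shows "weak_upper_gradient \<mu> p (\<lambda>x. ereal (truncation A B (u x))) (\<lambda>x. g x * indicator {A<..<B} (u x))"
proof -
  have g_meas: "g \<in> borel_measurable M"
    and g_ae: "almost_every_path \<mu> p
      (\<lambda>(a, b, \<gamma>). ennreal \<bar>u (\<gamma> a) - u (\<gamma> b)\<bar> \<le> path_integral (a, b, \<gamma>) g)"
    using g(1) by (auto simp: weak_upper_gradient_real)
  have "open (\<Omega> \<inter> u -` {A<..<B})"
    using continuous_open_preimage[OF u(1) \<Omega>] by simp
  then have "(\<lambda>x. g x * indicator (\<Omega> \<inter> u -` {A<..<B}) x) \<in> borel_measurable M"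
    using g_meas by (intro borel_measurable_times_ennreal borel_measurable_indicator sets_M_borel) auto
  also have "(\<lambda>x. g x * indicator (\<Omega> \<inter> u -` {A<..<B}) x) = (\<lambda>x. g x * indicator {A<..<B} (u x))"
    using u(2) AB by (force simp: fun_eq_iff split: split_indicator)
  finally have meas: "(\<lambda>x. g x * indicator {A<..<B} (u x)) \<in> borel_measurable M" .
  have "(\<lambda>x. g x * indicator \<Omega> x) \<in> borel_measurable M"
    using g_meas \<Omega> by (intro borel_measurable_times_ennreal borel_measurable_indicator sets_M_borel) auto
  moreover have "(\<integral>\<^sup>+x. (g x * indicator \<Omega> x) epowr p \<partial>M) < \<infinity>"
  proof -
    have "(\<lambda>x. (g x * indicator \<Omega> x) epowr p) = (\<lambda>x. g x epowr p * indicator \<Omega> x)"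
      by (auto split: split_indicator)
    with g(2) show ?thesis by simp
  qed
  ultimately obtain F where F: "F \<in> borel_measurable borel" "\<And>x. g x * indicator \<Omega> x \<le> F x"
      "(\<integral>\<^sup>+x. F x epowr p \<partial>M) < \<infinity>"
    using borel_majorant_Lp p by blast
  have "almost_every_path \<mu> p
    (\<lambda>(a, b, \<gamma>). ennreal \<bar>truncation A B (u (\<gamma> a)) - truncation A B (u (\<gamma> b))\<bar>
      \<le> path_integral (a, b, \<gamma>) (\<lambda>x. g x * indicator {A<..<B} (u x)))"
  proof (rule almost_every_path_mono[OF almost_every_path_conj
        [OF almost_every_path_subpaths[OF g_ae] almost_every_path_finite_integral[OF F(1,3)]]], clarify)
    fix a b :: real and \<gamma> :: "real \<Rightarrow> 'a"
    assume c: "(a, b, \<gamma>) \<in> rect_paths"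
      and sub: "\<forall>s t. a \<le> s \<longrightarrow> s \<le> t \<longrightarrow> t \<le> b \<longrightarrow> (s, t, \<gamma>) \<in> rect_paths \<longrightarrow>
        ennreal \<bar>u (\<gamma> s) - u (\<gamma> t)\<bar> \<le> path_integral (s, t, \<gamma>) g"
      and fin: "path_integral (a, b, \<gamma>) F < \<infinity>"
    interpret rectifiable_path \<gamma> a b
      using c by unfold_locales (auto simp: rect_paths_def)
    \<comment> \<open>The arc length parametrization, extended by constants to the whole line.\<close>
    define \<beta> where "\<beta> r = \<alpha> (max 0 (min (len b) r))" for r
    have \<beta>: "\<beta> r = \<alpha> r" if "r \<in> {0..len b}" for r
      using that by (simp add: \<beta>_def)
    have \<beta>_cont: "continuous_on UNIV \<beta>"
      unfolding \<beta>_def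
      by (rule continuous_on_compose2[OF continuous_arclength_param]) (auto intro!: continuous_intros)
    have "ennreal \<bar>truncation A B (u (\<beta> 0)) - truncation A B (u (\<beta> (len b)))\<bar>
      \<le> (\<integral>\<^sup>+r\<in>{0..len b}. g (\<beta> r) * indicator {A<..<B} (u (\<beta> r)) \<partial>lebesgue)"
    proof (rule truncated_difference_le[where U = "\<beta> -` \<Omega>" and H = "\<lambda>r. F (\<beta> r)"])
      show "open (\<beta> -` \<Omega>)"
        using \<Omega> \<beta>_cont by (rule open_vimage)
      show "continuous_on (\<beta> -` \<Omega>) (\<lambda>r. u (\<beta> r))"
        by (rule continuous_on_compose2[OF u(1)]) (auto intro: continuous_on_subset[OF \<beta>_cont])
      show "g (\<beta> r) \<le> F (\<beta> r)" if "r \<in> \<beta> -` \<Omega>" for r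
        using F(2)[of "\<beta> r"] that by simp
      have "\<beta> \<in> borel_measurable borel"
        using \<beta>_cont by (rule borel_measurable_continuous_onI)
      then have "(\<lambda>r. F (\<beta> r)) \<in> borel_measurable borel"
        using F(1) by measurable
      then show "(\<lambda>r. F (\<beta> r)) \<in> borel_measurable lebesgue"
        by (intro measurable_completion) simp
      have "(\<integral>\<^sup>+r\<in>{0..len b}. F (\<beta> r) \<partial>lebesgue) = path_integral (a, b, \<gamma>) F"
        unfolding path_integral_eq by (intro nn_integral_cong) (simp add: \<beta> split: split_indicator)
      with fin show "(\<integral>\<^sup>+r\<in>{0..len b}. F (\<beta> r) \<partial>lebesgue) < \<infinity>" by simp
      fix \<sigma> \<tau> assume \<sigma>\<tau>: "0 \<le> \<sigma>" "\<sigma> < \<tau>" "\<tau> \<le> len b"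
      obtain s where s: "s \<in> {a..b}" "len s = \<sigma>"
        using len_attained[of \<sigma>] \<sigma>\<tau> by auto
      obtain t where t: "t \<in> {a..b}" "len t = \<tau>"
        using len_attained[of \<tau>] \<sigma>\<tau> by auto
      have st: "s \<le> t"
        using path_length_sub(2)[of t s] s t \<sigma>\<tau> by (cases "s \<le> t") auto
      have \<beta>_st: "\<beta> \<sigma> = \<gamma> s" "\<beta> \<tau> = \<gamma> t"
        using arclength_param_len[OF s(1)] arclength_param_len[OF t(1)] s(2) t(2) \<sigma>\<tau> by (simp_all add: \<beta>)
      show "ennreal \<bar>u (\<beta> \<sigma>) - u (\<beta> \<tau>)\<bar> \<le> (\<integral>\<^sup>+r\<in>{\<sigma>..\<tau>}. g (\<beta> r) \<partial>lebesgue)"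
      proof (cases "\<gamma> constant_on {s..t}")
        case True
        then have "\<gamma> s = \<gamma> t" using st by (auto simp: constant_on_def)
        then show ?thesis by (simp add: \<beta>_st)
      next
        case False
        interpret sub: rectifiable_path \<gamma> s t
          using subpath[of s t] s t st by simp
        have "(s, t, \<gamma>) \<in> rect_paths"
          using False st sub.continuous sub.finite_length by (simp add: rect_paths_def)
        then have "ennreal \<bar>u (\<beta> \<sigma>) - u (\<beta> \<tau>)\<bar> \<le> path_integral (s, t, \<gamma>) g"
          using sub s t st by (simp add: \<beta>_st)
        also have "\<dots> = (\<integral>\<^sup>+r\<in>{\<sigma>..\<tau>}. g (\<beta> r) \<partial>lebesgue)"
        proof -
          have "\<beta> r = \<alpha> r" if "r \<in> {\<sigma>..\<tau>}" for r
            using that \<sigma>\<tau> by (simp add: \<beta>)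
          moreover have "path_integral (s, t, \<gamma>) g = (\<integral>\<^sup>+r\<in>{\<sigma>..\<tau>}. g (\<alpha> r) \<partial>lebesgue)"
            using path_integral_subpath[of s t g] s t st by simp
          ultimately show ?thesis
            by (auto intro!: nn_integral_cong split: split_indicator)
        qed
        finally show ?thesis .
      qed
    qed (use u(2) AB in auto)
    also have "(\<integral>\<^sup>+r\<in>{0..len b}. g (\<beta> r) * indicator {A<..<B} (u (\<beta> r)) \<partial>lebesgue)
      = path_integral (a, b, \<gamma>) (\<lambda>x. g x * indicator {A<..<B} (u x))"
      unfolding path_integral_eq by (intro nn_integral_cong) (simp add: \<beta> split: split_indicator)
    also have "\<beta> 0 = \<gamma> a"
      using arclength_param_len[of a] a_le_b by (simp add: \<beta>)
    also have "\<beta> (len b) = \<gamma> b"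
      using arclength_param_len[of b] a_le_b by (simp add: \<beta>)
    finally show "ennreal \<bar>truncation A B (u (\<gamma> a)) - truncation A B (u (\<gamma> b))\<bar>
      \<le> path_integral (a, b, \<gamma>) (\<lambda>x. g x * indicator {A<..<B} (u x))" .
  qed
  with meas show ?thesis by (simp add: weak_upper_gradient_real)
qed

end


section \<open>Sums of weak upper gradients and test functions\<close>

lemma path_integral_superhomogeneous:
  "k * path_integral c g \<le> path_integral c (\<lambda>x. k * g x)"
  using nn_integral_superhomogeneous
  by (auto simp: path_integral_def mult.assoc split: prod.split)

lemma path_integral_sum_le:
  "(\<Sum>j\<in>J. path_integral c (g j)) \<le> path_integral c (\<lambda>x. \<Sum>j\<in>J. g j x)"
  using nn_integral_sum_le
  by (auto simp: path_integral_def sum_distrib_right split: prod.split)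

context borel_regular
begin

lemma weak_upper_gradient_affine:
  assumes "weak_upper_gradient \<mu> p (\<lambda>x. ereal (u x)) g" "0 \<le> k"
  shows "weak_upper_gradient \<mu> p (\<lambda>x. ereal (k * u x + d)) (\<lambda>x. ennreal k * g x)"
proof -
  have "ennreal \<bar>(k * s + d) - (k * t + d)\<bar> \<le> path_integral c (\<lambda>x. ennreal k * g x)"
    if "ennreal \<bar>s - t\<bar> \<le> path_integral c g" for s t c
  proof -
    have "ennreal \<bar>(k * s + d) - (k * t + d)\<bar> = ennreal k * ennreal \<bar>s - t\<bar>"
      using assms(2) by (simp add: ennreal_mult[symmetric] abs_mult flip: right_diff_distrib)
    also have "\<dots> \<le> ennreal k * path_integral c g"
      using that by (intro mult_left_mono) auto
    also have "\<dots> \<le> path_integral c (\<lambda>x. ennreal k * g x)"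
      by (rule path_integral_superhomogeneous)
    finally show ?thesis .
  qed
  then show ?thesis
    using assms(1) unfolding weak_upper_gradient_real
    by (auto elim!: almost_every_path_mono)
qed

lemma weak_upper_gradient_abs:
  assumes "weak_upper_gradient \<mu> p (\<lambda>x. ereal (u x)) g"
  shows "weak_upper_gradient \<mu> p (\<lambda>x. ereal \<bar>u x\<bar>) g"
proof -
  have "ennreal \<bar>\<bar>s\<bar> - \<bar>t\<bar>\<bar> \<le> P" if "ennreal \<bar>s - t\<bar> \<le> P" for s t :: real and P
    using that by (rule order_trans[rotated]) (auto intro: ennreal_leI)
  then show ?thesis
    using assms unfolding weak_upper_gradient_real
    by (auto elim!: almost_every_path_mono)
qed

lemma weak_upper_gradient_0: "weak_upper_gradient \<mu> p (\<lambda>x. ereal 0) (\<lambda>x. 0)"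
  unfolding weak_upper_gradient_real almost_every_path_def zero_modulus_def
  by (auto intro!: bexI[of _ "\<lambda>_. 0"])

lemma weak_upper_gradient_sum:
  assumes "finite J" "\<And>j. j \<in> J \<Longrightarrow> weak_upper_gradient \<mu> p (\<lambda>x. ereal (u j x)) (g j)"
  shows "weak_upper_gradient \<mu> p (\<lambda>x. ereal (\<Sum>j\<in>J. u j x)) (\<lambda>x. \<Sum>j\<in>J. g j x)"
proof -
  have "almost_every_path \<mu> p
      (\<lambda>(a, b, \<gamma>). \<forall>j\<in>J. ennreal \<bar>u j (\<gamma> a) - u j (\<gamma> b)\<bar> \<le> path_integral (a, b, \<gamma>) (g j))"
    using assms
  proof (induction J)
    case empty
    then show ?case
      using weak_upper_gradient_0[of p] unfolding weak_upper_gradient_real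
      by (auto elim!: almost_every_path_mono)
  next
    case (insert i J)
    then have "almost_every_path \<mu> p (\<lambda>(a, b, \<gamma>). ennreal \<bar>u i (\<gamma> a) - u i (\<gamma> b)\<bar> \<le> path_integral (a, b, \<gamma>) (g i))"
      by (simp add: weak_upper_gradient_real)
    from almost_every_path_conj[OF this insert.IH] insert.prems show ?case
      by (auto elim!: almost_every_path_mono)
  qed
  moreover have "ennreal \<bar>(\<Sum>j\<in>J. s j) - (\<Sum>j\<in>J. t j)\<bar> \<le> path_integral c (\<lambda>x. \<Sum>j\<in>J. g j x)"
    if "\<forall>j\<in>J. ennreal \<bar>s j - t j\<bar> \<le> path_integral c (g j)" for s t c
  proof -
    have "ennreal \<bar>(\<Sum>j\<in>J. s j) - (\<Sum>j\<in>J. t j)\<bar> \<le> ennreal (\<Sum>j\<in>J. \<bar>s j - t j\<bar>)"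
      unfolding sum_subtractf[symmetric] by (intro ennreal_leI sum_abs)
    also have "\<dots> = (\<Sum>j\<in>J. ennreal \<bar>s j - t j\<bar>)" by (simp add: sum_ennreal)
    also have "\<dots> \<le> (\<Sum>j\<in>J. path_integral c (g j))" using that by (intro sum_mono) auto
    also have "\<dots> \<le> path_integral c (\<lambda>x. \<Sum>j\<in>J. g j x)" by (rule path_integral_sum_le)
    finally show ?thesis .
  qed
  moreover have "(\<lambda>x. \<Sum>j\<in>J. g j x) \<in> borel_measurable M"
    using assms by (intro borel_measurable_sum) (simp add: weak_upper_gradient_real)
  ultimately show ?thesis
    unfolding weak_upper_gradient_real by (auto elim!: almost_every_path_mono)
qed

lemma sobolev_capacity_empty:
  assumes "0 < p"
  shows "sobolev_capacity \<mu> p {} = 0"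
proof -
  have "(INF g \<in> {g. weak_upper_gradient \<mu> p (\<lambda>x. ereal 0) g}. \<integral>\<^sup>+x. g x epowr p \<partial>M) \<le> 0"
    using weak_upper_gradient_0 by (intro INF_lower2[of "\<lambda>_. 0"]) auto
  then have norm: "newtonian_norm \<mu> p (\<lambda>x. 0) = 0"
    by (simp add: newtonian_norm_def zero_ereal_def)
  then have "(\<lambda>x. 0) \<in> newtonian_space \<mu> p"
    by (simp add: newtonian_space_def)
  then have "sobolev_capacity \<mu> p {} \<le> newtonian_norm \<mu> p (\<lambda>x. 0) epowr p"
    unfolding sobolev_capacity_def by (intro INF_lower) auto
  with norm show ?thesis by simp
qed

lemma newtonian_0_cont_zero_outside:
  assumes "u \<in> newtonian_0_cont \<mu> p \<Omega>" "x \<notin> \<Omega>"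
  shows "u x = 0"
proof -
  obtain v where "(\<lambda>x. ereal (u x)) = (\<lambda>x. if x \<in> \<Omega> then v x else 0)"
    using assms(1) by (auto simp: newtonian_0_cont_def newtonian_space_0_def)
  from fun_cong[OF this, of x] show ?thesis using assms(2) by simp
qed

lemma borel_measurable_zero_outside:
  fixes u :: "'a \<Rightarrow> real"
  assumes "open \<Omega>" "continuous_on \<Omega> u" "\<And>x. x \<notin> \<Omega> \<Longrightarrow> u x = 0"
  shows "u \<in> borel_measurable borel"
proof -
  have "(\<lambda>x. if x \<in> \<Omega> then u x else 0) \<in> borel_measurable borel"
    using assms by (intro borel_measurable_continuous_on_if) auto
  also have "(\<lambda>x. if x \<in> \<Omega> then u x else 0) = u"
    using assms(3) by auto
  finally show ?thesis .
qed

lemma newtonian_0_contI: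
  assumes p: "0 < p" and \<Omega>: "open \<Omega>" "\<mu> \<Omega> < \<infinity>"
    and u: "continuous_on \<Omega> u" "\<And>x. x \<notin> \<Omega> \<Longrightarrow> u x = 0" "\<And>x. \<bar>u x\<bar> \<le> K"
    and g: "weak_upper_gradient \<mu> p (\<lambda>x. ereal (u x)) g" "(\<integral>\<^sup>+x. g x epowr p \<partial>M) < \<infinity>"
  shows "u \<in> newtonian_0_cont \<mu> p \<Omega>"
proof -
  have meas: "u \<in> borel_measurable borel"
    using \<Omega>(1) u(1,2) by (rule borel_measurable_zero_outside)
  have "(\<integral>\<^sup>+x. ennreal \<bar>u x\<bar> epowr p \<partial>M) \<le> (\<integral>\<^sup>+x. ennreal (K powr p) * indicator \<Omega> x \<partial>M)"
    using u p by (intro nn_integral_mono)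
      (auto simp: epowr_ennreal intro!: ennreal_leI powr_mono2 split: split_indicator)
  also have "\<dots> < \<infinity>"
    using \<Omega> emeasure_M[OF sets_M_borel, of \<Omega>]
    by (subst nn_integral_cmult_indicator) (auto intro: sets_M_borel simp: ennreal_mult_less_top)
  finally have "(\<integral>\<^sup>+x. ennreal \<bar>u x\<bar> epowr p \<partial>M) < \<infinity>" .
  moreover have "(INF g \<in> {g. weak_upper_gradient \<mu> p (\<lambda>x. ereal (u x)) g}. \<integral>\<^sup>+x. g x epowr p \<partial>M) < \<infinity>"
    using g by (intro le_less_trans[OF INF_lower]) auto
  ultimately have "newtonian_norm \<mu> p (\<lambda>x. ereal (u x)) < \<infinity>"
    by (simp add: newtonian_norm_def ennreal_add_less_top)
  moreover have "(\<lambda>x. ereal (u x)) \<in> borel_measurable M"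
    using meas by (intro borel_measurable_ereal borel_measurable_M)
  ultimately have "(\<lambda>x. ereal (u x)) \<in> newtonian_space \<mu> p"
    by (simp add: newtonian_space_def)
  moreover have "quasieverywhere_on \<mu> p (- \<Omega>) (\<lambda>x. ereal (u x) = 0)"
  proof -
    have "{x \<in> - \<Omega>. \<not> ereal (u x) = 0} = {}" using u(2) by auto
    then show ?thesis
      using sobolev_capacity_empty[OF p] by (simp only: quasieverywhere_on_def)
  qed
  moreover have "(\<lambda>x. ereal (u x)) = (\<lambda>x. if x \<in> \<Omega> then ereal (u x) else 0)"
    using u(2) by auto
  ultimately have "(\<lambda>x. ereal (u x)) \<in> newtonian_space_0 \<mu> p \<Omega>"
    unfolding newtonian_space_0_def by (intro CollectI exI[of _ "\<lambda>x. ereal (u x)"] conjI)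
  with u(1) show ?thesis by (simp add: newtonian_0_cont_def)
qed

end

lemma sum_epowr_disjoint:
  assumes "finite J" "\<And>i j. i \<in> J \<Longrightarrow> j \<in> J \<Longrightarrow> f i \<noteq> 0 \<Longrightarrow> f j \<noteq> 0 \<Longrightarrow> i = j"
  shows "(\<Sum>j\<in>J. f j) epowr p = (\<Sum>j\<in>J. f j epowr p)"
proof (cases "\<exists>i\<in>J. f i \<noteq> 0")
  case True
  then obtain i where i: "i \<in> J" "f i \<noteq> 0" by blast
  then have zero: "f j = 0" if "j \<in> J - {i}" for j
    using assms(2) that by blast
  have "(\<Sum>j\<in>J. f j) = f i" "(\<Sum>j\<in>J. f j epowr p) = f i epowr p"
    using zero i assms(1) by (simp_all add: sum.remove)
  then show ?thesis by simp
qed auto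

lemma sum_powr_le_powr_sum:
  fixes a :: "'i \<Rightarrow> real"
  assumes "1 \<le> q" "\<And>j. j \<in> J \<Longrightarrow> 0 \<le> a j"
  shows "(\<Sum>j\<in>J. a j powr q) \<le> (\<Sum>j\<in>J. a j) powr q"
proof (cases "finite J")
  case True
  define S where "S = (\<Sum>j\<in>J. a j)"
  have S: "0 \<le> S" "\<And>j. j \<in> J \<Longrightarrow> a j \<le> S"
    using assms(2) True by (auto simp: S_def intro: sum_nonneg member_le_sum)
  have split: "r powr q = r * r powr (q - 1)" if "0 \<le> r" for r :: real
    using that by (simp add: powr_mult_base)
  have "(\<Sum>j\<in>J. a j powr q) \<le> (\<Sum>j\<in>J. a j * S powr (q - 1))"
    using assms S by (intro sum_mono) (auto simp: split intro!: mult_left_mono powr_mono2)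
  also have "\<dots> = S powr q"
    using S by (simp add: S_def split sum_distrib_right)
  finally show ?thesis by (simp add: S_def)
qed auto

text \<open>The truncations of the competitors for nested condensers have gradients that live on disjoint
  strips, so the energies of their multiples add up in spite of the \<open>p\<close>-th power.  At a point \<open>x\<close>,
  the sum \<open>f\<close> is at least the sum of the \<open>a j\<close> with \<open>x \<in> E j\<close>, hence \<open>f\<^bsup>q\<^esup>\<close> is at least the sum of
  their \<open>q\<close>-th powers, because \<open>q \<ge> 1\<close>.\<close>

lemma nested_condensers_test_function:
  fixes E :: "int \<Rightarrow> 'a::metric_space set" and u :: "int \<Rightarrow> 'a \<Rightarrow> real" and g :: "int \<Rightarrow> 'a \<Rightarrow> ennreal"
  assumes \<mu>: "borel_regular \<mu>" and \<nu>: "borel_regular \<nu>"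
    and p: "0 < p" and q: "1 \<le> q" and \<Omega>: "open \<Omega>" "\<mu> \<Omega> < \<infinity>" and J: "finite J"
    and u: "\<And>j. j \<in> J \<Longrightarrow> continuous_on \<Omega> (u j)" "\<And>j x. j \<in> J \<Longrightarrow> x \<in> E j \<Longrightarrow> u j x = 1"
      "\<And>j x. j \<in> J \<Longrightarrow> x \<notin> E (j + 1) \<Longrightarrow> u j x = 0"
    and g: "\<And>j. j \<in> J \<Longrightarrow> weak_upper_gradient \<mu> p (\<lambda>x. ereal (u j x)) (g j)"
      "\<And>j. j \<in> J \<Longrightarrow> (\<integral>\<^sup>+x\<in>\<Omega>. g j x epowr p \<partial>om_measure \<mu>) < \<infinity>"
    and E: "\<And>j. j \<in> J \<Longrightarrow> E (j + 1) \<subseteq> \<Omega>"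
      "\<And>i j. i \<in> J \<Longrightarrow> j \<in> J \<Longrightarrow> i < j \<Longrightarrow> E (i + 1) \<subseteq> E j"
    and a: "\<And>j. j \<in> J \<Longrightarrow> 0 \<le> a j"
  obtains f G where "f \<in> newtonian_0_cont \<mu> p \<Omega>" "weak_upper_gradient \<mu> p (\<lambda>x. ereal (f x)) G"
    "(\<integral>\<^sup>+x\<in>\<Omega>. G x epowr p \<partial>om_measure \<mu>)
      \<le> (\<Sum>j\<in>J. ennreal (a j powr p) * (\<integral>\<^sup>+x\<in>\<Omega>. g j x epowr p \<partial>om_measure \<mu>))"
    "(\<Sum>j\<in>J. ennreal (a j powr q) * \<nu> (E j)) \<le> (\<integral>\<^sup>+x\<in>\<Omega>. ennreal (\<bar>f x\<bar> powr q) \<partial>om_measure \<nu>)"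
proof -
  interpret \<mu>: borel_regular \<mu> by (rule \<mu>)
  interpret \<nu>: borel_regular \<nu> by (rule \<nu>)
  define v where "v j x = truncation 0 1 (u j x)" for j x
  define h where "h j x = g j x * indicator {0<..<1} (u j x)" for j x
  define f where "f x = (\<Sum>j\<in>J. a j * v j x)" for x
  define G where "G x = (\<Sum>j\<in>J. ennreal (a j) * h j x)" for x
  have u_out: "u j x = 0" if "j \<in> J" "x \<notin> \<Omega>" for j x
    using u(3)[of j x] E(1)[of j] that by auto
  have v01: "0 \<le> v j x" "v j x \<le> 1" for j x by (auto simp: v_def truncation_def)
  have v_cont: "continuous_on \<Omega> (v j)" if "j \<in> J" for j
    unfolding v_def truncation_def using u(1)[OF that] by (auto intro!: continuous_intros)
  have v_out: "v j x = 0" if "j \<in> J" "x \<notin> \<Omega>" for j x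
    using u_out[OF that] by (simp add: v_def truncation_def)
  have v_E: "v j x = 1" if "j \<in> J" "x \<in> E j" for j x
    using u(2)[OF that] by (simp add: v_def truncation_def)
  have h_wug: "weak_upper_gradient \<mu> p (\<lambda>x. ereal (v j x)) (h j)" if "j \<in> J" for j
    unfolding v_def h_def
    using that p \<Omega> u(1) u_out g by (intro \<mu>.weak_upper_gradient_truncation) auto
  have h_out: "h j x = 0" if "j \<in> J" "x \<notin> \<Omega>" for j x
    using u_out[OF that] by (simp add: h_def)
  have h_disj: "i = j" if "i \<in> J" "j \<in> J" "h i x \<noteq> 0" "h j x \<noteq> 0" for i j x
  proof -
    have "\<not> i < j" if ij: "i \<in> J" "j \<in> J" "h i x \<noteq> 0" "h j x \<noteq> 0" for i j
    proof
      assume "i < j"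
      have "x \<in> E (i + 1)" using ij u(3)[of i x] by (cases "x \<in> E (i + 1)") (auto simp: h_def)
      then have "u j x = 1" using E(2)[OF ij(1,2) \<open>i < j\<close>] u(2)[of j x] ij by auto
      then show False using ij(4) by (simp add: h_def)
    qed
    from this[of i j] this[of j i] that show ?thesis by auto
  qed
  have f_wug: "weak_upper_gradient \<mu> p (\<lambda>x. ereal (f x)) G"
    unfolding f_def G_def
    using J \<mu>.weak_upper_gradient_affine[OF h_wug, where d = 0] a
    by (intro \<mu>.weak_upper_gradient_sum) auto
  have f_cont: "continuous_on \<Omega> f"
    unfolding f_def using v_cont by (intro continuous_intros) auto
  have f_out: "f x = 0" if "x \<notin> \<Omega>" for x
    using v_out that by (simp add: f_def)
  have f_nonneg: "0 \<le> f x" for x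
    unfolding f_def using a v01 by (intro sum_nonneg) auto
  have f_bound: "\<bar>f x\<bar> \<le> (\<Sum>j\<in>J. a j)" for x
    using f_nonneg[of x] a v01 by (auto simp: f_def intro!: sum_mono mult_left_le)
  have G_out: "G x = 0" if "x \<notin> \<Omega>" for x
    using h_out that by (simp add: G_def)
  have Gp: "G x epowr p = (\<Sum>j\<in>J. ennreal (a j powr p) * (h j x epowr p))" for x
  proof -
    have "G x epowr p = (\<Sum>j\<in>J. (ennreal (a j) * h j x) epowr p)"
      unfolding G_def using h_disj J by (intro sum_epowr_disjoint) auto
    also have "\<dots> = (\<Sum>j\<in>J. ennreal (a j powr p) * (h j x epowr p))"
      using a by (intro sum.cong) (auto simp: epowr_mult epowr_ennreal)
    finally show ?thesis .
  qed
  have h_meas: "h j \<in> borel_measurable \<mu>.M" if "j \<in> J" for j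
    using h_wug[OF that] by (simp add: \<mu>.weak_upper_gradient_real)
  have "(\<integral>\<^sup>+x. G x epowr p \<partial>\<mu>.M) = (\<Sum>j\<in>J. ennreal (a j powr p) * (\<integral>\<^sup>+x. h j x epowr p \<partial>\<mu>.M))"
    unfolding Gp using h_meas by (simp add: nn_integral_sum nn_integral_cmult)
  also have "\<dots> \<le> (\<Sum>j\<in>J. ennreal (a j powr p) * (\<integral>\<^sup>+x\<in>\<Omega>. g j x epowr p \<partial>\<mu>.M))"
  proof (intro sum_mono mult_left_mono nn_integral_mono)
    fix j x assume "j \<in> J"
    then show "h j x epowr p \<le> g j x epowr p * indicator \<Omega> x"
      using h_out[of j x] by (cases "x \<in> \<Omega>") (auto simp: h_def split: split_indicator)
  qed auto
  finally have energy: "(\<integral>\<^sup>+x. G x epowr p \<partial>\<mu>.M)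
      \<le> (\<Sum>j\<in>J. ennreal (a j powr p) * (\<integral>\<^sup>+x\<in>\<Omega>. g j x epowr p \<partial>\<mu>.M))" .
  also have "\<dots> < \<infinity>"
    using g(2) J by (auto simp: ennreal_mult_less_top)
  finally have "f \<in> newtonian_0_cont \<mu> p \<Omega>"
    using p \<Omega> f_cont f_out f_bound f_wug by (intro \<mu>.newtonian_0_contI) auto
  moreover have "(\<integral>\<^sup>+x\<in>\<Omega>. G x epowr p \<partial>\<mu>.M) \<le> (\<integral>\<^sup>+x. G x epowr p \<partial>\<mu>.M)"
    by (intro nn_integral_mono) (auto split: split_indicator)
  moreover have "(\<Sum>j\<in>J. ennreal (a j powr q) * \<nu> (E j)) \<le> (\<integral>\<^sup>+x\<in>\<Omega>. ennreal (\<bar>f x\<bar> powr q) \<partial>\<nu>.M)"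
  proof -
    \<comment> \<open>The sets \<open>E j\<close> need not be measurable; they are replaced by the larger Borel sets on which the
      truncations equal \<open>1\<close>.\<close>
    define D where "D j = {x. v j x = 1}" for j
    have "v j \<in> borel_measurable borel" if "j \<in> J" for j
      using \<Omega>(1) v_cont[OF that] v_out[OF that] by (rule \<mu>.borel_measurable_zero_outside)
    then have D: "D j \<in> sets \<nu>.M" if "j \<in> J" for j
      unfolding D_def using that by (intro \<nu>.sets_M_borel) auto
    have "(\<Sum>j\<in>J. ennreal (a j powr q) * \<nu> (E j)) \<le> (\<Sum>j\<in>J. ennreal (a j powr q) * emeasure \<nu>.M (D j))"
      using D v_E by (intro sum_mono mult_left_mono) (auto simp: \<nu>.emeasure_M D_def intro!: \<nu>.outer_mono)
    also have "\<dots> = (\<integral>\<^sup>+x. (\<Sum>j\<in>J. ennreal (a j powr q) * indicator (D j) x) \<partial>\<nu>.M)"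
      using D by (simp add: nn_integral_sum nn_integral_cmult_indicator)
    also have "\<dots> \<le> (\<integral>\<^sup>+x\<in>\<Omega>. ennreal (\<bar>f x\<bar> powr q) \<partial>\<nu>.M)"
    proof (rule nn_integral_mono)
      fix x
      have "(\<Sum>j\<in>J. ennreal (a j powr q) * indicator (D j) x) = ennreal (\<Sum>j\<in>J. (a j * indicator (D j) x) powr q)"
        by (subst sum_ennreal[symmetric]) (auto intro!: sum.cong simp del: sum_ennreal split: split_indicator)
      also have "\<dots> \<le> ennreal ((\<Sum>j\<in>J. a j * indicator (D j) x) powr q)"
        using a q by (intro ennreal_leI sum_powr_le_powr_sum) auto
      also have "\<dots> \<le> ennreal (\<bar>f x\<bar> powr q)"
      proof (intro ennreal_leI powr_mono2)
        have "(\<Sum>j\<in>J. a j * indicator (D j) x) \<le> f x"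
          unfolding f_def using a v01
          by (intro sum_mono mult_left_mono) (auto simp: D_def split: split_indicator)
        then show "(\<Sum>j\<in>J. a j * indicator (D j) x) \<le> \<bar>f x\<bar>" by simp
      qed (use a q in \<open>auto intro!: sum_nonneg\<close>)
      finally have le: "(\<Sum>j\<in>J. ennreal (a j powr q) * indicator (D j) x) \<le> ennreal (\<bar>f x\<bar> powr q)" .
      then show "(\<Sum>j\<in>J. ennreal (a j powr q) * indicator (D j) x) \<le> ennreal (\<bar>f x\<bar> powr q) * indicator \<Omega> x"
        using f_out[of x] by (cases "x \<in> \<Omega>") auto
    qed
    finally show ?thesis .
  qed
  ultimately show thesis
    using that[OF _ f_wug] energy by (blast intro: order_trans)
qed


section \<open>Necessity of the capacitary condition\<close>

definition sobolev_inequality ::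
    "('a::metric_space set \<Rightarrow> ennreal) \<Rightarrow> ('a set \<Rightarrow> ennreal) \<Rightarrow> real \<Rightarrow> real \<Rightarrow> 'a set \<Rightarrow> real \<Rightarrow> bool"
  where "sobolev_inequality \<mu> \<nu> p q \<Omega> c \<longleftrightarrow> (\<forall>u\<in>newtonian_0_cont \<mu> p \<Omega>. \<forall>g.
    weak_upper_gradient \<mu> p (\<lambda>x. ereal (u x)) g \<longrightarrow>
    (\<integral>\<^sup>+x\<in>\<Omega>. ennreal (\<bar>u x\<bar> powr q) \<partial>om_measure \<nu>) epowr (1 / q)
      \<le> ennreal c * (\<integral>\<^sup>+x\<in>\<Omega>. g x epowr p \<partial>om_measure \<mu>) epowr (1 / p))"

lemma sobolev_inequalityD:
  assumes "sobolev_inequality \<mu> \<nu> p q \<Omega> c" "u \<in> newtonian_0_cont \<mu> p \<Omega>"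
    "weak_upper_gradient \<mu> p (\<lambda>x. ereal (u x)) g"
  shows "(\<integral>\<^sup>+x\<in>\<Omega>. ennreal (\<bar>u x\<bar> powr q) \<partial>om_measure \<nu>) epowr (1 / q)
      \<le> ennreal c * (\<integral>\<^sup>+x\<in>\<Omega>. g x epowr p \<partial>om_measure \<mu>) epowr (1 / p)"
  using assms unfolding sobolev_inequality_def by blast

text \<open>Truncated competitors for the capacity are test functions.  The inequality forces \<open>\<nu> E = 0\<close> when the
  capacity vanishes and \<open>\<nu> E < \<infinity>\<close> when it is finite, so only terms with positive finite capacity
  contribute to the capacitary sum.\<close>

lemma isocapacitary_inequality:
  assumes \<mu>: "borel_regular \<mu>" and \<nu>: "borel_regular \<nu>"
    and q: "1 \<le> q" "q < p" and \<Omega>: "open \<Omega>" "\<mu> \<Omega> < \<infinity>" and C: "0 < C"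
    and S: "sobolev_inequality \<mu> \<nu> p q \<Omega> C" and EF: "E \<subseteq> F" "F \<subseteq> \<Omega>"
  shows "\<nu> E epowr (p / q) \<le> cap \<mu> p \<Omega> E F * ennreal (C powr p)"
proof -
  let ?K = "ennreal (C powr p)"
  have K: "?K \<noteq> 0" "?K < top" using C by auto
  have "\<nu> E epowr (p / q) / ?K \<le> cap \<mu> p \<Omega> E F"
    unfolding cap_def
  proof (rule INF_greatest, clarify)
    fix u :: "'a \<Rightarrow> real" and g
    assume u: "continuous_on \<Omega> u" "\<forall>x\<in>E. u x = 1" "\<forall>x\<in>-F. u x = 0"
      and g: "weak_upper_gradient \<mu> p (\<lambda>x. ereal (u x)) g"
    define e where "e = (\<integral>\<^sup>+x\<in>\<Omega>. g x epowr p \<partial>om_measure \<mu>)"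
    show "\<nu> E epowr (p / q) / ?K \<le> (\<integral>\<^sup>+x\<in>\<Omega>. g x epowr p \<partial>om_measure \<mu>)"
    proof (cases "e < \<infinity>")
      case False
      then show ?thesis by (simp add: e_def less_top[symmetric])
    next
      case True
      define E' where "E' j = (if j \<le> (0::int) then E else F)" for j
      obtain f G where f: "f \<in> newtonian_0_cont \<mu> p \<Omega>" "weak_upper_gradient \<mu> p (\<lambda>x. ereal (f x)) G"
        and G: "(\<integral>\<^sup>+x\<in>\<Omega>. G x epowr p \<partial>om_measure \<mu>) \<le> e"
        and E: "\<nu> E \<le> (\<integral>\<^sup>+x\<in>\<Omega>. ennreal (\<bar>f x\<bar> powr q) \<partial>om_measure \<nu>)"
        by (rule nested_condensers_test_function[OF \<mu> \<nu> _ q(1) \<Omega>,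
              where p = p and J = "{0}" and E = E' and u = "\<lambda>_. u" and g = "\<lambda>_. g" and a = "\<lambda>_. 1"])
          (use q u g True EF in \<open>auto simp: E'_def e_def\<close>)
      have "\<nu> E epowr (1 / q) \<le> ennreal C * e epowr (1 / p)"
        using epowr_mono[OF _ E, of "1 / q"] sobolev_inequalityD[OF S f] q
          mult_left_mono[OF epowr_mono[OF _ G, of "1 / p"], of "ennreal C"]
        by (auto intro: order_trans)
      then have "(\<nu> E epowr (1 / q)) epowr p \<le> (ennreal C * e epowr (1 / p)) epowr p"
        using q by (intro epowr_mono) auto
      then have "\<nu> E epowr (p / q) \<le> ?K * e"
        using q C by (simp add: epowr_epowr epowr_mult epowr_ennreal)
      then show ?thesis
        unfolding e_def[symmetric]
        by (intro divide_le_posI_ennreal) (use C in auto)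
    qed
  qed
  from mult_right_mono[OF this, of ?K] show ?thesis
    using K by (simp add: ennreal_divide_times)
qed

text \<open>With the weights \<open>(\<nu>\<^sub>j / c\<^sub>j)\<^bsup>1/(p-q)\<^esup>\<close> both sums that occur in the Sobolev inequality for the test
  function, the one with \<open>\<nu>\<close> and the one with the capacities, have the same terms as the capacitary
  sum \<open>S\<close>.  With energies up to twice the capacities the inequality becomes
  \<open>S\<^bsup>1/q\<^esup> \<le> C (2 S)\<^bsup>1/p\<^esup>\<close>, and \<open>q < p\<close> makes this a bound for \<open>S\<close>.\<close>

lemma optimal_weight:
  fixes n k :: real
  assumes "0 \<le> n" "0 < k" "1 \<le> q" "q < p"
  defines "a \<equiv> (n / k) powr (1 / (p - q))" and "T \<equiv> (n powr (p / q) / k) powr (q / (p - q))"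
  shows "a powr q * n = T" and "a powr p * k = T"
proof -
  have "a powr q * n = T \<and> a powr p * k = T"
  proof (cases "n = 0")
    case True
    then show ?thesis using assms by simp
  next
    case False
    with assms have n: "0 < n" by simp
    have pq: "0 < p - q" "0 < q" "0 < p" using assms by auto
    have T: "T = n powr (p / (p - q)) * k powr (- (q / (p - q)))"
      using n assms pq by (simp add: T_def powr_divide powr_powr powr_minus_divide)
    have "a powr q * n = n powr (q / (p - q) + 1) * k powr (- (q / (p - q)))"
      using n assms pq by (simp add: a_def powr_divide powr_powr powr_minus_divide powr_add)
    moreover have "q / (p - q) + 1 = p / (p - q)" using pq by (simp add: field_simps)
    moreover have "a powr p * k = n powr (p / (p - q)) * k powr (1 - p / (p - q))"
      using n assms pq by (simp add: a_def powr_divide powr_powr powr_diff)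
    moreover have "1 - p / (p - q) = - (q / (p - q))" using pq by (simp add: field_simps)
    ultimately show ?thesis by (simp only: T)
  qed
  then show "a powr q * n = T" "a powr p * k = T" by auto
qed

lemma self_improving_bound:
  fixes S C :: real
  assumes S: "0 \<le> S" and C: "0 < C" and q: "1 \<le> q" "q < p"
    and le: "S powr (1 / q) \<le> C * (2 * S) powr (1 / p)"
  shows "S powr ((p - q) / q) \<le> 2 * C powr p"
proof (cases "S = 0")
  case True
  then show ?thesis using C by simp
next
  case False
  with S have S: "0 < S" by simp
  have "(S powr (1 / q)) powr p \<le> (C * (2 * S) powr (1 / p)) powr p"
    using le q by (intro powr_mono2) auto
  then have "S powr (p / q) \<le> C powr p * (2 * S)"
    using q S C by (simp add: powr_mult powr_powr)
  moreover have "S powr (p / q) = S powr ((p - q) / q) * S"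
  proof -
    have "p / q = (p - q) / q + 1" using q by (simp add: field_simps)
    then show ?thesis using S by (simp add: powr_add)
  qed
  ultimately have "S powr ((p - q) / q) * S \<le> (2 * C powr p) * S" by (simp add: mult_ac)
  then show ?thesis using S by (simp only: mult_le_cancel_right_pos)
qed

lemma capacitary_gamma_le:
  assumes \<mu>: "borel_regular \<mu>" and \<nu>: "borel_regular \<nu>"
    and q: "1 \<le> q" "q < p" and \<Omega>: "open \<Omega>" "\<mu> \<Omega> < \<infinity>" and C: "0 < C"
    and S: "sobolev_inequality \<mu> \<nu> p q \<Omega> C"
  shows "capacitary_gamma \<mu> \<nu> p q \<Omega> \<le> ennreal (2 * C powr p)"
  unfolding capacitary_gamma_def
proof (rule SUP_least, clarify)
  fix N :: nat and E :: "int \<Rightarrow> 'a set"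
  assume E\<Omega>: "\<forall>j\<in>{- int N..int N + 1}. E j \<subseteq> \<Omega>" and mono: "\<forall>j\<in>{- int N..int N}. E j \<subseteq> E (j + 1)"
  let ?I = "{- int N..int N}"
  define c where "c j = cap \<mu> p \<Omega> (E j) (E (j + 1))" for j
  define summand where "summand j = (\<nu> (E j) epowr (p / q) / c j) epowr (q / (p - q))" for j
  have E: "E j \<subseteq> E (j + 1)" "E (j + 1) \<subseteq> \<Omega>" if "j \<in> ?I" for j
    using E\<Omega> mono that by auto
  have E_nested: "E i \<subseteq> E j" if "i \<le> j" "- int N \<le> i" "j \<le> int N + 1" for i j
    using that
  proof (induction j rule: int_ge_induct)
    case (step j)
    then have "E i \<subseteq> E j" "E j \<subseteq> E (j + 1)"
      using E(1)[of j] by simp_all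
    then show ?case by (rule subset_trans)
  qed simp
  have iso: "\<nu> (E j) epowr (p / q) \<le> c j * ennreal (C powr p)" if "j \<in> ?I" for j
    unfolding c_def using isocapacitary_inequality[OF \<mu> \<nu> q \<Omega> C S E(1,2)] that by simp
  define J where "J = {j \<in> ?I. 0 < c j \<and> c j < \<infinity>}"
  have J_sub: "J \<subseteq> ?I" by (auto simp: J_def)
  note J = J_sub finite_subset[OF J_sub finite_atLeastAtMost_int]
  define k n where "k j = enn2real (c j)" and "n j = enn2real (\<nu> (E j))" for j
  have k: "c j = ennreal (k j)" "0 < k j" if "j \<in> J" for j
    using that by (auto simp: J_def k_def enn2real_positive_iff)
  have n: "\<nu> (E j) = ennreal (n j)" if "j \<in> J" for j
  proof -
    have "\<nu> (E j) epowr (p / q) < \<infinity>"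
      using iso[of j] that J by (intro le_less_trans[OF iso]) (auto simp: J_def ennreal_mult_less_top)
    then show ?thesis by (simp add: n_def)
  qed
  have n0: "0 \<le> n j" for j by (simp add: n_def)
  define T where "T j = (n j powr (p / q) / k j) powr (q / (p - q))" for j
  have summand_J: "summand j = ennreal (T j)" if "j \<in> J" for j
    using k[OF that] n[OF that] n0 q by (simp add: summand_def T_def epowr_ennreal divide_ennreal)
  have summand_0: "summand j = 0" if "j \<in> ?I - J" for j
  proof -
    have "c j = 0 \<or> c j = \<infinity>" using that by (auto simp: J_def less_top[symmetric])
    then show ?thesis
    proof
      assume "c j = 0"
      with iso[of j] that show ?thesis by (simp add: summand_def)
    next
      assume "c j = \<infinity>"
      then show ?thesis by (simp add: summand_def)
    qed
  qed
  define ST where "ST = (\<Sum>j\<in>J. T j)"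
  have ST0: "0 \<le> ST" by (simp add: ST_def T_def sum_nonneg)
  have sum_eq: "(\<Sum>j\<in>?I. summand j) = ennreal ST"
  proof -
    have "(\<Sum>j\<in>?I. summand j) = (\<Sum>j\<in>J. summand j)"
      using J summand_0 by (intro sum.mono_neutral_right) auto
    also have "\<dots> = ennreal ST"
      using summand_J by (simp add: ST_def sum_ennreal T_def)
    finally show ?thesis .
  qed
  \<comment> \<open>The capacities need not be attained, so competitors with at most twice the least energy are
    taken.\<close>
  define admissible where "admissible j u g \<longleftrightarrow> continuous_on \<Omega> u \<and> (\<forall>x\<in>E j. u x = 1) \<and>
      (\<forall>x\<in>- E (j + 1). u x = 0) \<and> weak_upper_gradient \<mu> p (\<lambda>x. ereal (u x)) g \<and>
      (\<integral>\<^sup>+x\<in>\<Omega>. g x epowr p \<partial>om_measure \<mu>) < ennreal (2 * k j)" for j and u :: "'a \<Rightarrow> real" and g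
  have "\<exists>u g. admissible j u g" if "j \<in> J" for j
  proof -
    have "cap \<mu> p \<Omega> (E j) (E (j + 1)) < ennreal (2 * k j)"
      using k[OF that] by (simp add: c_def ennreal_less_iff)
    then show ?thesis unfolding cap_def INF_less_iff admissible_def by auto
  qed
  then obtain u g where "\<And>j. j \<in> J \<Longrightarrow> admissible j (u j) (g j)"
    by metis
  then have u: "\<And>j. j \<in> J \<Longrightarrow> continuous_on \<Omega> (u j)" "\<And>j x. j \<in> J \<Longrightarrow> x \<in> E j \<Longrightarrow> u j x = 1"
      "\<And>j x. j \<in> J \<Longrightarrow> x \<notin> E (j + 1) \<Longrightarrow> u j x = 0"
    and g: "\<And>j. j \<in> J \<Longrightarrow> weak_upper_gradient \<mu> p (\<lambda>x. ereal (u j x)) (g j)"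
      "\<And>j. j \<in> J \<Longrightarrow> (\<integral>\<^sup>+x\<in>\<Omega>. g j x epowr p \<partial>om_measure \<mu>) < ennreal (2 * k j)"
    by (simp_all add: admissible_def)
  define a where "a j = (n j / k j) powr (1 / (p - q))" for j
  have aT: "a j powr q * n j = T j" "a j powr p * k j = T j" if "j \<in> J" for j
    unfolding a_def T_def using optimal_weight[OF n0 k(2)[OF that] q] by auto
  have a0: "0 \<le> a j" for j by (simp add: a_def)
  have gfin: "(\<integral>\<^sup>+x\<in>\<Omega>. g j x epowr p \<partial>om_measure \<mu>) < \<infinity>" if "j \<in> J" for j
    using g(2)[OF that] by (simp add: less_top[symmetric]) auto
  have EJ: "E (j + 1) \<subseteq> \<Omega>" if "j \<in> J" for j
    using E J(1) that by blast
  have p0: "0 < p" using q by simp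
  have Jnest: "E (i + 1) \<subseteq> E j" if "i \<in> J" "j \<in> J" "i < j" for i j
    using that J by (intro E_nested) auto
  obtain f G where f: "f \<in> newtonian_0_cont \<mu> p \<Omega>" "weak_upper_gradient \<mu> p (\<lambda>x. ereal (f x)) G"
    and G: "(\<integral>\<^sup>+x\<in>\<Omega>. G x epowr p \<partial>om_measure \<mu>)
      \<le> (\<Sum>j\<in>J. ennreal (a j powr p) * (\<integral>\<^sup>+x\<in>\<Omega>. g j x epowr p \<partial>om_measure \<mu>))"
    and F: "(\<Sum>j\<in>J. ennreal (a j powr q) * \<nu> (E j)) \<le> (\<integral>\<^sup>+x\<in>\<Omega>. ennreal (\<bar>f x\<bar> powr q) \<partial>om_measure \<nu>)"
    by (rule nested_condensers_test_function[where u = u and g = g and E = E and a = a,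
          OF \<mu> \<nu> p0 q(1) \<Omega> J(2) u g(1) gfin EJ Jnest a0])
  have "(\<Sum>j\<in>J. ennreal (a j powr q) * \<nu> (E j)) = ennreal ST"
    using n n0 aT(1) by (simp add: ST_def T_def ennreal_mult[symmetric] sum_ennreal)
  moreover have "(\<Sum>j\<in>J. ennreal (a j powr p) * (\<integral>\<^sup>+x\<in>\<Omega>. g j x epowr p \<partial>om_measure \<mu>)) \<le> ennreal (2 * ST)"
  proof -
    have "(\<Sum>j\<in>J. ennreal (a j powr p) * (\<integral>\<^sup>+x\<in>\<Omega>. g j x epowr p \<partial>om_measure \<mu>))
      \<le> (\<Sum>j\<in>J. ennreal (a j powr p) * ennreal (2 * k j))"
      using g(2) by (intro sum_mono mult_left_mono) (auto intro: less_imp_le)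
    also have "\<dots> = (\<Sum>j\<in>J. ennreal (2 * T j))"
    proof (rule sum.cong[OF refl])
      fix j assume "j \<in> J"
      then have "2 * T j = a j powr p * (2 * k j)" using aT(2)[of j] by simp
      then show "ennreal (a j powr p) * ennreal (2 * k j) = ennreal (2 * T j)"
        using k(2)[OF \<open>j \<in> J\<close>] by (simp add: ennreal_mult mult.left_commute)
    qed
    also have "\<dots> = ennreal (2 * ST)"
      by (simp add: ST_def T_def sum_ennreal sum_distrib_left)
    finally show ?thesis .
  qed
  ultimately have "ennreal ST epowr (1 / q) \<le> ennreal C * ennreal (2 * ST) epowr (1 / p)"
    using epowr_mono[OF _ F, of "1 / q"] sobolev_inequalityD[OF S f] q
      mult_left_mono[OF epowr_mono[OF _ G, of "1 / p"], of "ennreal C"]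
      mult_left_mono[OF epowr_mono, of "1/p" _ "ennreal (2 * ST)" "ennreal C"]
    by (auto intro: order_trans)
  then have "ennreal (ST powr (1 / q)) \<le> ennreal (C * (2 * ST) powr (1 / p))"
    using ST0 C epowr_ennreal[of "2 * ST" "1 / p"] by (simp add: epowr_ennreal ennreal_mult)
  then have "ST powr (1 / q) \<le> C * (2 * ST) powr (1 / p)"
    using C by (subst (asm) ennreal_le_iff) auto
  then have "ST powr ((p - q) / q) \<le> 2 * C powr p"
    using ST0 C q by (intro self_improving_bound)
  then have "(\<Sum>j\<in>?I. summand j) epowr ((p - q) / q) \<le> ennreal (2 * C powr p)"
    unfolding sum_eq using ST0 by (simp add: epowr_ennreal ennreal_leI)
  then show "(\<Sum>j = - int N..int N. (\<nu> (E j) epowr (p / q) / cap \<mu> p \<Omega> (E j) (E (j + 1))) epowr (q / (p - q)))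
      epowr ((p - q) / q) \<le> ennreal (2 * C powr p)"
    by (simp only: summand_def c_def)
qed


section \<open>Sufficiency of the capacitary condition\<close>

text \<open>Young's inequality for the terms, normalized by the two sums.\<close>

lemma Hoelder_sum:
  fixes x y :: "'i \<Rightarrow> real"
  assumes t: "0 < t" "t < 1" and x: "\<And>i. i \<in> I \<Longrightarrow> 0 \<le> x i" and y: "\<And>i. i \<in> I \<Longrightarrow> 0 \<le> y i"
  shows "(\<Sum>i\<in>I. x i powr (1 - t) * y i powr t) \<le> (\<Sum>i\<in>I. x i) powr (1 - t) * (\<Sum>i\<in>I. y i) powr t"
proof (cases "finite I")
  case True
  define X Y where "X = (\<Sum>i\<in>I. x i)" and "Y = (\<Sum>i\<in>I. y i)"
  have XY: "0 \<le> X" "0 \<le> Y" using x y by (auto simp: X_def Y_def intro: sum_nonneg)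
  show ?thesis
  proof (cases "X = 0 \<or> Y = 0")
    case True
    then have "\<forall>i\<in>I. x i = 0 \<or> y i = 0"
      using x y \<open>finite I\<close> by (auto simp: X_def Y_def sum_nonneg_eq_0_iff)
    then have "(\<Sum>i\<in>I. x i powr (1 - t) * y i powr t) = 0"
      by (intro sum.neutral) auto
    then show ?thesis by simp
  next
    case False
    with XY have XY: "0 < X" "0 < Y" by auto
    have "(\<Sum>i\<in>I. x i powr (1 - t) * y i powr t)
      \<le> (\<Sum>i\<in>I. X powr (1 - t) * Y powr t * ((1 - t) * (x i / X) + t * (y i / Y)))"
    proof (rule sum_mono)
      fix i assume i: "i \<in> I"
      show "x i powr (1 - t) * y i powr t \<le> X powr (1 - t) * Y powr t * ((1 - t) * (x i / X) + t * (y i / Y))"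
      proof (cases "x i = 0 \<or> y i = 0")
        case True
        then show ?thesis using x[OF i] y[OF i] XY t by auto
      next
        case False
        then have "0 < x i" "0 < y i" using x[OF i] y[OF i] by auto
        then have "(x i / X) powr (1 - t) * (y i / Y) powr t \<le> (1 - t) * (x i / X) + t * (y i / Y)"
          using XY t by (intro Youngs_inequality_0) auto
        then have "X powr (1 - t) * Y powr t * ((x i / X) powr (1 - t) * (y i / Y) powr t)
            \<le> X powr (1 - t) * Y powr t * ((1 - t) * (x i / X) + t * (y i / Y))"
          by (intro mult_left_mono) auto
        then show ?thesis using XY by (simp add: powr_divide)
      qed
    qed
    also have "\<dots> = X powr (1 - t) * Y powr t * ((1 - t) * (X / X) + t * (Y / Y))"
      unfolding X_def Y_def
      by (simp add: sum_distrib_left[symmetric] sum.distrib sum_divide_distrib[symmetric])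
    also have "\<dots> = X powr (1 - t) * Y powr t" using XY by simp
    finally show ?thesis by (simp add: X_def Y_def)
  qed
qed auto

text \<open>A point at which \<open>\<bar>u\<bar>\<close> lies in \<open>(2\<^bsup>-j\<^esup>, 2\<^bsup>1-j\<^esup>]\<close> belongs to the \<open>j\<close>-th superlevel set, whose term alone
  dominates \<open>\<bar>u\<bar>\<^bsup>q\<^esup>\<close> there.  The finite sums cover the levels between \<open>2\<^bsup>-N\<^esup>\<close> and \<open>2\<^bsup>N+1\<^esup>\<close>, and these
  truncated domains exhaust the set where \<open>u\<close> is not zero.\<close>

lemma (in borel_regular) dyadic_levels_bound:
  fixes u :: "'a \<Rightarrow> real"
  assumes \<Omega>: "open \<Omega>" "continuous_on \<Omega> u" and q: "0 < q"
    and K: "\<And>N. 0 < N \<Longrightarrow> (\<Sum>j = - int N..int N. ennreal ((2 powr (1 - real_of_int j)) powr q) *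
      \<mu> {x \<in> \<Omega>. 2 powr (- real_of_int j) < \<bar>u x\<bar>}) \<le> K"
  shows "(\<integral>\<^sup>+x\<in>\<Omega>. ennreal (\<bar>u x\<bar> powr q) \<partial>M) \<le> K"
proof -
  define E where "E j = {x \<in> \<Omega>. 2 powr (- real_of_int j) < \<bar>u x\<bar>}" for j :: int
  define D where "D N = E (int (Suc N)) - E (- int (Suc (Suc N)))" for N
  define f where "f N x = ennreal (\<bar>u x\<bar> powr q) * indicator (D N) x" for N x
  have E_sets: "E j \<in> sets M" for j
  proof -
    have "continuous_on \<Omega> (\<lambda>x. \<bar>u x\<bar>)" using \<Omega>(2) by (intro continuous_intros)
    from continuous_open_preimage[OF this \<Omega>(1), of "{2 powr (- real_of_int j)<..}"]
    have "open (E j)" by (simp add: E_def vimage_def Int_def)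
    then show ?thesis by (intro sets_M_borel) auto
  qed
  have level: "E i \<subseteq> E j" if "i \<le> j" for i j
  proof -
    have "(2::real) powr (- real_of_int j) \<le> 2 powr (- real_of_int i)" using that by simp
    from le_less_trans[OF this] show ?thesis unfolding E_def by blast
  qed
  have f_meas: "f N \<in> borel_measurable M" for N
  proof -
    have "(\<lambda>x. if x \<in> \<Omega> then u x else 0) \<in> borel_measurable borel"
      using \<Omega> by (intro borel_measurable_continuous_on_if) auto
    from borel_measurable_M[OF measurable_compose[OF this, of "\<lambda>r. ennreal (\<bar>r\<bar> powr q)"]]
    have "(\<lambda>x. ennreal (\<bar>if x \<in> \<Omega> then u x else 0\<bar> powr q) * indicator (D N) x) \<in> borel_measurable M"
      using E_sets by (intro borel_measurable_times_ennreal borel_measurable_indicator) (auto simp: D_def)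
    also have "(\<lambda>x. ennreal (\<bar>if x \<in> \<Omega> then u x else 0\<bar> powr q) * indicator (D N) x) = f N"
      by (auto simp: f_def D_def E_def fun_eq_iff split: split_indicator)
    finally show ?thesis .
  qed
  have "D N \<subseteq> D (Suc N)" for N
    unfolding D_def using level[of "int (Suc N)" "int (Suc (Suc N))"]
      level[of "- int (Suc (Suc (Suc N)))" "- int (Suc (Suc N))"] by auto
  then have "f N \<le> f (Suc N)" for N
    by (auto simp: le_fun_def f_def split: split_indicator)
  then have f_inc: "incseq f" by (rule incseq_SucI)
  have f_le: "f N x \<le> (\<Sum>j = - int (Suc N)..int (Suc N). ennreal ((2 powr (1 - real_of_int j)) powr q) * indicator (E j) x)"
    for N x
  proof (cases "x \<in> D N")
    case True
    let ?L = "{j \<in> {- int (Suc N)..int (Suc N)}. x \<in> E j}"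
    define j where "j = Min ?L"
    have fin: "finite ?L" by (rule finite_subset[of _ "{- int (Suc N)..int (Suc N)}"]) auto
    have "int (Suc N) \<in> ?L" using True by (auto simp: D_def)
    then have j: "j \<in> ?L" unfolding j_def using fin by (intro Min_in) auto
    have "x \<notin> E (j - 1)"
    proof (cases "j = - int (Suc N)")
      case True
      then have eq: "j - 1 = - int (Suc (Suc N))" by simp
      show ?thesis using \<open>x \<in> D N\<close> unfolding D_def eq by blast
    next
      case False
      show ?thesis
      proof
        assume "x \<in> E (j - 1)"
        with j False have "j - 1 \<in> ?L" by auto
        then have "j \<le> j - 1" unfolding j_def by (rule Min_le[OF fin])
        then show False by simp
      qed
    qed
    then have "\<bar>u x\<bar> \<le> 2 powr (1 - real_of_int j)"
      using j by (auto simp: E_def not_less)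
    then have "f N x \<le> ennreal ((2 powr (1 - real_of_int j)) powr q) * indicator (E j) x"
      using j q True by (auto simp: f_def intro!: ennreal_leI powr_mono2)
    also have "\<dots> \<le> (\<Sum>j = - int (Suc N)..int (Suc N). ennreal ((2 powr (1 - real_of_int j)) powr q) * indicator (E j) x)"
      using j by (intro member_le_sum) auto
    finally show ?thesis .
  qed (auto simp: f_def)
  have f_int: "(\<integral>\<^sup>+x. f N x \<partial>M) \<le> K" for N
  proof -
    have "(\<integral>\<^sup>+x. f N x \<partial>M) \<le> (\<integral>\<^sup>+x. (\<Sum>j = - int (Suc N)..int (Suc N).
        ennreal ((2 powr (1 - real_of_int j)) powr q) * indicator (E j) x) \<partial>M)"
      using f_le by (intro nn_integral_mono) auto
    also have "\<dots> = (\<Sum>j = - int (Suc N)..int (Suc N). ennreal ((2 powr (1 - real_of_int j)) powr q) * \<mu> (E j))"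
      using E_sets by (subst nn_integral_sum)
        (auto simp: nn_integral_cmult_indicator emeasure_M simp del: sum_ennreal intro!: sum.cong
          borel_measurable_times_ennreal borel_measurable_indicator)
    also have "\<dots> \<le> K" using K[of "Suc N"] by (simp add: E_def)
    finally show ?thesis .
  qed
  have "ennreal (\<bar>u x\<bar> powr q) * indicator \<Omega> x \<le> (SUP N. f N x)" for x
  proof (cases "x \<in> \<Omega> \<and> u x \<noteq> 0")
    case True
    obtain k :: nat where k: "1 / \<bar>u x\<bar> < real k" using reals_Archimedean2 by blast
    obtain l :: nat where l: "\<bar>u x\<bar> < real l" using reals_Archimedean2 by blast
    define N where "N = k + l"
    have big: "real m < 2 powr real m'" if "m \<le> m'" for m m' :: nat
    proof -
      have "real m < 2 ^ m" by simp
      also have "\<dots> \<le> (2::real) ^ m'" using that by (intro power_increasing) auto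
      finally show ?thesis by (simp add: powr_realpow)
    qed
    have "1 / \<bar>u x\<bar> < 2 powr real (Suc N)"
      using k big[of k "Suc N"] by (simp add: N_def)
    then have "1 / 2 powr real (Suc N) < \<bar>u x\<bar>"
      using True by (simp add: field_simps)
    then have "x \<in> E (int (Suc N))"
      using True unfolding E_def of_int_of_nat_eq powr_minus_divide by blast
    moreover have "x \<notin> E (- int (Suc (Suc N)))"
      using l big[of l "Suc (Suc N)"] by (simp add: E_def N_def algebra_simps)
    ultimately have "ennreal (\<bar>u x\<bar> powr q) * indicator \<Omega> x = f N x"
      using True by (simp add: f_def D_def)
    then show ?thesis by (auto intro: SUP_upper2)
  qed auto
  then have "(\<integral>\<^sup>+x\<in>\<Omega>. ennreal (\<bar>u x\<bar> powr q) \<partial>M) \<le> (\<integral>\<^sup>+x. (SUP N. f N x) \<partial>M)"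
    by (intro nn_integral_mono) auto
  also have "\<dots> = (SUP N. \<integral>\<^sup>+x. f N x \<partial>M)"
    using f_inc f_meas by (rule nn_integral_monotone_convergence_SUP)
  also have "\<dots> \<le> K" using f_int by (intro SUP_least) auto
  finally show ?thesis .
qed

text \<open>This factorization prepares Hoelder's inequality with exponents \<open>p/(p-q)\<close> and \<open>p/q\<close>: the first factor
  comes from a term of the capacitary sum, the second from an energy.  If \<open>k = 0\<close>, both sides vanish.\<close>

lemma weighted_measure_factorization:
  fixes n k r :: real
  assumes "0 \<le> n" "0 \<le> k" "0 < r" "1 \<le> q" "q < p" "k = 0 \<Longrightarrow> n = 0"
  shows "r powr q * n = ((n powr (p / q) / k) powr (q / (p - q))) powr (1 - q / p) * (r powr p * k) powr (q / p)"
proof (cases "k = 0")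
  case True
  then show ?thesis using assms by simp
next
  case False
  with assms have k: "0 < k" by simp
  have e: "q / (p - q) * (1 - q / p) = q / p" using assms by (simp add: field_simps)
  have "((n powr (p / q) / k) powr (q / (p - q))) powr (1 - q / p) = n / k powr (q / p)"
    using assms k by (simp only: powr_powr e) (simp add: powr_divide powr_powr)
  moreover have "(r powr p * k) powr (q / p) = r powr q * k powr (q / p)"
    using assms k by (simp add: powr_mult powr_powr)
  ultimately show ?thesis using k by simp
qed

text \<open>On the levels \<open>2\<^bsup>-j\<^esup>\<close> of \<open>\<bar>u\<bar>\<close> the rescaled truncations of \<open>\<bar>u\<bar>\<close> are admissible for the capacities of
  consecutive level sets, and their energies are those of \<open>g\<close> on disjoint strips.\<close>

lemma (in borel_regular) level_set_capacities:
  assumes p: "0 < p" and \<Omega>: "open \<Omega>" and u: "continuous_on \<Omega> u" "\<And>x. x \<notin> \<Omega> \<Longrightarrow> u x = 0"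
    and g: "weak_upper_gradient \<mu> p (\<lambda>x. ereal (u x)) g" "(\<integral>\<^sup>+x\<in>\<Omega>. g x epowr p \<partial>M) < \<infinity>"
    and J: "finite J"
  defines "E \<equiv> \<lambda>j::int. {x \<in> \<Omega>. 2 powr (- real_of_int j) < \<bar>u x\<bar>}"
  shows "(\<Sum>j\<in>J. ennreal ((2 powr (- real_of_int j - 1)) powr p) * cap \<mu> p \<Omega> (E j) (E (j + 1)))
    \<le> (\<integral>\<^sup>+x\<in>\<Omega>. g x epowr p \<partial>M)"
proof -
  define s where "s j = (2::real) powr (- real_of_int j)" for j :: int
  have s: "0 < s j" "s j = 2 * s (j + 1)" for j
  proof -
    show "0 < s j" by (simp add: s_def)
    have "2 * s (j + 1) = 2 powr (1 + - real_of_int (j + 1))"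
      unfolding s_def by (subst powr_add) simp
    then show "s j = 2 * s (j + 1)" by (simp add: s_def)
  qed
  have s_mono: "s i \<le> s j" if "j \<le> i" for i j
    using that by (simp add: s_def)
  have E: "E j = {x \<in> \<Omega>. s j < \<bar>u x\<bar>}" for j by (simp add: E_def s_def)
  define S where "S j = {s (j + 1)<..<s j}" for j
  define h where "h j x = g x * indicator (S j) \<bar>u x\<bar>" for j x
  have abs_cont: "continuous_on \<Omega> (\<lambda>x. \<bar>u x\<bar>)" using u(1) by (intro continuous_intros)
  have h_wug: "weak_upper_gradient \<mu> p (\<lambda>x. ereal (truncation (s (j + 1)) (s j) \<bar>u x\<bar>)) (h j)" for j
    unfolding h_def S_def
    using p \<Omega> abs_cont u(2) weak_upper_gradient_abs[OF g(1)] g(2) s(1)[of "j + 1"] s(1,2)[of j]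
    by (intro weak_upper_gradient_truncation[where \<Omega> = \<Omega>]) auto
  have h_meas: "h j \<in> borel_measurable M" for j
    using h_wug by (simp add: weak_upper_gradient_real)
  have cap_le: "ennreal (s (j + 1) powr p) * cap \<mu> p \<Omega> (E j) (E (j + 1)) \<le> (\<integral>\<^sup>+x\<in>\<Omega>. h j x epowr p \<partial>M)" for j
  proof -
    define k where "k = 1 / s (j + 1)"
    define v where "v x = k * truncation (s (j + 1)) (s j) \<bar>u x\<bar> + - 1" for x
    have k: "0 < k" "k * s (j + 1) = 1" "k * s j = 2"
      using s(1)[of "j + 1"] s(2)[of j] by (auto simp: k_def)
    have "weak_upper_gradient \<mu> p (\<lambda>x. ereal (v x)) (\<lambda>x. ennreal k * h j x)"
      unfolding v_def using h_wug k by (intro weak_upper_gradient_affine) auto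
    moreover have "continuous_on \<Omega> v"
      unfolding v_def truncation_def using u(1) by (intro continuous_intros)
    moreover have "v x = 1" if "x \<in> E j" for x
      using that s(2)[of j] s(1)[of "j+1"] k by (auto simp: v_def truncation_def E)
    moreover have "v x = 0" if "x \<notin> E (j + 1)" for x
      using that s(2)[of j] s(1)[of "j+1"] k u(2)[of x]
      by (cases "x \<in> \<Omega>") (auto simp: v_def truncation_def E)
    ultimately have "cap \<mu> p \<Omega> (E j) (E (j + 1)) \<le> (\<integral>\<^sup>+x\<in>\<Omega>. (ennreal k * h j x) epowr p \<partial>M)"
      unfolding cap_def by (intro INF_lower2[of "(v, \<lambda>x. ennreal k * h j x)"]) auto
    also have "\<dots> = ennreal (k powr p) * (\<integral>\<^sup>+x\<in>\<Omega>. h j x epowr p \<partial>M)"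
    proof -
      have "(\<lambda>x. h j x epowr p * indicator \<Omega> x) \<in> borel_measurable M"
        using h_meas \<Omega> by (intro borel_measurable_times_ennreal borel_measurable_epowr borel_measurable_indicator sets_M_borel) auto
      then show ?thesis
        using k by (simp add: epowr_mult epowr_ennreal mult.assoc nn_integral_cmult)
    qed
    finally have "ennreal (s (j + 1) powr p) * cap \<mu> p \<Omega> (E j) (E (j + 1))
      \<le> ennreal (s (j + 1) powr p) * (ennreal (k powr p) * (\<integral>\<^sup>+x\<in>\<Omega>. h j x epowr p \<partial>M))"
      by (intro mult_left_mono) auto
    also have "\<dots> = ennreal ((k * s (j + 1)) powr p) * (\<integral>\<^sup>+x\<in>\<Omega>. h j x epowr p \<partial>M)"
      by (simp add: mult.assoc[symmetric] ennreal_mult[symmetric] powr_mult mult.commute)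
    finally show ?thesis using k by simp
  qed
  have disj: "i = j" if "r \<in> S i" "r \<in> S j" for i j r
  proof -
    have "\<not> i < j" if ij: "r \<in> S i" "r \<in> S j" for i j
      using ij s_mono[of "i + 1" j] by (auto simp: S_def)
    from this[of i j] this[of j i] that show ?thesis by auto
  qed
  have "(\<Sum>j\<in>J. ennreal (s (j + 1) powr p) * cap \<mu> p \<Omega> (E j) (E (j + 1))) \<le> (\<Sum>j\<in>J. \<integral>\<^sup>+x\<in>\<Omega>. h j x epowr p \<partial>M)"
    by (intro sum_mono cap_le)
  also have "\<dots> \<le> (\<integral>\<^sup>+x. (\<Sum>j\<in>J. h j x epowr p * indicator \<Omega> x) \<partial>M)"
    by (rule nn_integral_sum_le)
  also have "\<dots> \<le> (\<integral>\<^sup>+x\<in>\<Omega>. g x epowr p \<partial>M)"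
  proof (intro nn_integral_mono)
    fix x
    have "(\<Sum>j\<in>J. h j x epowr p) = (\<Sum>j\<in>J. h j x) epowr p"
      using J disj by (intro sum_epowr_disjoint[symmetric]) (auto simp: h_def indicator_def split: if_splits)
    also have "(\<Sum>j\<in>J. h j x) \<le> g x"
    proof (cases "\<exists>i\<in>J. \<bar>u x\<bar> \<in> S i")
      case True
      then obtain i where i: "i \<in> J" "\<bar>u x\<bar> \<in> S i" by blast
      then have "h j x = 0" if "j \<in> J - {i}" for j
        using disj[of "\<bar>u x\<bar>" i j] that by (auto simp: h_def indicator_def)
      then have "(\<Sum>j\<in>J. h j x) = h i x" using J i by (simp add: sum.remove)
      then show ?thesis using i by (simp add: h_def)
    qed (auto simp: h_def)
    finally show "(\<Sum>j\<in>J. h j x epowr p * indicator \<Omega> x) \<le> g x epowr p * indicator \<Omega> x"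
      using p by (auto simp: sum_distrib_right[symmetric] epowr_mono intro!: mult_right_mono)
  qed
  finally show ?thesis by (simp add: s_def)
qed


text \<open>Hoelder's inequality separates the capacitary sum of the dyadic superlevel sets, which is bounded by
  means of \<open>\<gamma>\<close>, from the sum of the scaled capacities, which is at most the energy.  The factor \<open>4\<close>
  is the ratio of the upper bound \<open>2\<^bsup>1-j\<^esup>\<close> of \<open>\<bar>u\<bar>\<close> on a level to the height \<open>2\<^bsup>-j-1\<^esup>\<close> of the truncation
  between the levels \<open>2\<^bsup>-j-1\<^esup>\<close> and \<open>2\<^bsup>-j\<^esup>\<close>; the summand \<open>1\<close> keeps the right-hand side infinite for
  infinite energy even if \<open>\<gamma> = 0\<close>.\<close>

lemma sobolev_inequality_of_capacitary_gamma:
  assumes \<mu>: "borel_regular \<mu>" and \<nu>: "borel_regular \<nu>"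
    and q: "1 \<le> q" "q < p" and \<Omega>: "open \<Omega>" and gamma: "capacitary_gamma \<mu> \<nu> p q \<Omega> < \<infinity>"
  shows "sobolev_inequality \<mu> \<nu> p q \<Omega> (4 * enn2real (capacitary_gamma \<mu> \<nu> p q \<Omega>) powr (1 / p) + 1)"
  unfolding sobolev_inequality_def
proof (intro ballI allI impI)
  interpret \<mu>: borel_regular \<mu> by (rule \<mu>)
  interpret \<nu>: borel_regular \<nu> by (rule \<nu>)
  define \<gamma> where "\<gamma> = enn2real (capacitary_gamma \<mu> \<nu> p q \<Omega>)"
  have \<gamma>: "capacitary_gamma \<mu> \<nu> p q \<Omega> = ennreal \<gamma>" "0 \<le> \<gamma>"
    using gamma by (auto simp: \<gamma>_def)
  have pq: "0 < p" "0 < q" "0 < p - q" using q by auto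
  fix u g assume u: "u \<in> newtonian_0_cont \<mu> p \<Omega>" and g: "weak_upper_gradient \<mu> p (\<lambda>x. ereal (u x)) g"
  have u_cont: "continuous_on \<Omega> u" using u by (simp add: newtonian_0_cont_def)
  have u_out: "u x = 0" if "x \<notin> \<Omega>" for x
    using \<mu>.newtonian_0_cont_zero_outside[OF u that] .
  define G where "G = (\<integral>\<^sup>+x\<in>\<Omega>. g x epowr p \<partial>\<mu>.M)"
  have "(\<integral>\<^sup>+x\<in>\<Omega>. ennreal (\<bar>u x\<bar> powr q) \<partial>\<nu>.M) epowr (1 / q) \<le> ennreal (4 * \<gamma> powr (1 / p) + 1) * G epowr (1 / p)"
  proof (cases "G = \<infinity>")
    case True
    have "0 < 4 * \<gamma> powr (1 / p) + 1" by (intro add_nonneg_pos) auto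
    then have "ennreal (4 * \<gamma> powr (1 / p) + 1) \<noteq> 0" by (simp del: ennreal_plus)
    then show ?thesis using True by (simp add: ennreal_mult_top del: ennreal_plus)
  next
    case False
    then obtain e where e: "G = ennreal e" "0 \<le> e" by (cases G) auto
    define E where "E j = {x \<in> \<Omega>. 2 powr (- real_of_int j) < \<bar>u x\<bar>}" for j :: int
    define r where "r j = (2::real) powr (- real_of_int j - 1)" for j :: int
    define c where "c j = cap \<mu> p \<Omega> (E j) (E (j + 1))" for j
    define summand where "summand j = (\<nu> (E j) epowr (p / q) / c j) epowr (q / (p - q))" for j
    define B where "B = 4 * \<gamma> powr (1 / p) * e powr (1 / p)"
    have r: "0 < r j" "2 powr (1 - real_of_int j) = 4 * r j" for j
    proof -
      show "0 < r j" by (simp add: r_def)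
      have "(4::real) = 2 powr 2" by simp
      then have "4 * r j = 2 powr (2 + (- real_of_int j - 1))"
        unfolding r_def powr_add by simp
      then show "2 powr (1 - real_of_int j) = 4 * r j" by simp
    qed
    have E_mono: "E j \<subseteq> E (j + 1)" for j
    proof -
      have "(2::real) powr (- real_of_int (j + 1)) \<le> 2 powr (- real_of_int j)" by simp
      from le_less_trans[OF this] show ?thesis unfolding E_def by blast
    qed
    have bound: "(\<Sum>j = - int N..int N. ennreal ((2 powr (1 - real_of_int j)) powr q) * \<nu> (E j)) \<le> ennreal (B powr q)"
      if N: "0 < N" for N
    proof -
      let ?I = "{- int N..int N}"
      have gamma_le: "(\<Sum>j\<in>?I. summand j) epowr ((p - q) / q) \<le> ennreal \<gamma>"
      proof -
        have "(N, E) \<in> {(N::nat, E::int \<Rightarrow> 'a set). 0 < N \<and>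
            (\<forall>j\<in>{- int N..int N + 1}. E j \<subseteq> \<Omega>) \<and> (\<forall>j\<in>{- int N..int N}. E j \<subseteq> E (j + 1))}"
          using N E_mono by (auto simp: E_def)
        then show ?thesis
          unfolding \<gamma>(1)[symmetric] capacitary_gamma_def summand_def c_def
          by (intro SUP_upper2[of "(N, E)"]) auto
      qed
      have energy: "(\<Sum>j\<in>?I. ennreal (r j powr p) * c j) \<le> ennreal e"
        using \<mu>.level_set_capacities[OF pq(1) \<Omega> u_cont u_out g, of ?I] False
        by (simp add: G_def[symmetric] e c_def E_def r_def less_top)
      have c_fin: "c j < \<infinity>" if "j \<in> ?I" for j
      proof -
        have "ennreal (r j powr p) * c j \<le> (\<Sum>j\<in>?I. ennreal (r j powr p) * c j)"
          using that by (intro member_le_sum) auto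
        also note energy
        finally have "ennreal (r j powr p) * c j < \<infinity>" by (simp add: le_less_trans)
        then show ?thesis using r(1)[of j] by (auto simp: ennreal_mult_less_top)
      qed
      have "(\<Sum>j\<in>?I. summand j) epowr ((p - q) / q) < \<infinity>"
        unfolding infinity_ennreal_def by (rule le_less_trans[OF gamma_le ennreal_less_top])
      then have s_fin: "summand j < \<infinity>" if "j \<in> ?I" for j
        using that by simp
      define k n where "k j = enn2real (c j)" and "n j = enn2real (\<nu> (E j))" for j
      have k: "c j = ennreal (k j)" "0 \<le> k j" if "j \<in> ?I" for j
        using c_fin[OF that] by (auto simp: k_def)
      have quot: "\<nu> (E j) epowr (p / q) / c j \<noteq> top" if "j \<in> ?I" for j
        using s_fin[OF that] by (simp add: summand_def less_top)
      have n: "\<nu> (E j) = ennreal (n j)" "0 \<le> n j" if "j \<in> ?I" for j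
        using quot[OF that] c_fin[OF that] by (auto simp: n_def ennreal_divide_eq_top_iff less_top)
      have n_0: "n j = 0" if "j \<in> ?I" "k j = 0" for j
        using quot[OF that(1)] k[OF that(1)] that(2) by (auto simp: n_def split: if_splits)
      define T where "T j = (n j powr (p / q) / k j) powr (q / (p - q))" for j
      have summand_T: "summand j = ennreal (T j)" if "j \<in> ?I" for j
      proof (cases "k j = 0")
        case True
        then show ?thesis using n[OF that] n_0[OF that] by (simp add: summand_def T_def)
      next
        case False
        then show ?thesis using n[OF that] k[OF that] by (simp add: summand_def T_def epowr_ennreal divide_ennreal)
      qed
      define ST where "ST = (\<Sum>j\<in>?I. T j)"
      have ST0: "0 \<le> ST" by (simp add: ST_def T_def sum_nonneg)
      have sum_ST: "(\<Sum>j\<in>?I. summand j) = ennreal ST"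
        using summand_T by (simp add: ST_def T_def sum_ennreal)
      have "ennreal (ST powr ((p - q) / q)) \<le> ennreal \<gamma>"
        using gamma_le ST0 by (simp add: sum_ST epowr_ennreal)
      then have "ST powr ((p - q) / q) \<le> \<gamma>" using \<gamma>(2) by simp
      then have "(ST powr ((p - q) / q)) powr (q / p) \<le> \<gamma> powr (q / p)"
        using pq by (intro powr_mono2) auto
      moreover have "(p - q) / q * (q / p) = 1 - q / p"
        using pq by (simp add: field_simps)
      ultimately have ST: "ST powr (1 - q / p) \<le> \<gamma> powr (q / p)"
        by (simp only: powr_powr)
      have "ennreal (\<Sum>j\<in>?I. r j powr p * k j) = (\<Sum>j\<in>?I. ennreal (r j powr p) * c j)"
        using k by (subst sum_ennreal[symmetric]) (auto simp: ennreal_mult simp del: sum_ennreal intro!: sum.cong)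
      also note energy
      finally have en: "(\<Sum>j\<in>?I. r j powr p * k j) \<le> e" using e(2) by simp
      have "(\<Sum>j\<in>?I. r j powr q * n j) = (\<Sum>j\<in>?I. T j powr (1 - q / p) * (r j powr p * k j) powr (q / p))"
        unfolding T_def using n(2) k(2) n_0 r(1) q by (intro sum.cong weighted_measure_factorization) auto
      also have "\<dots> \<le> ST powr (1 - q / p) * (\<Sum>j\<in>?I. r j powr p * k j) powr (q / p)"
        unfolding ST_def using k(2) pq by (intro Hoelder_sum) (auto simp: T_def)
      also have "\<dots> \<le> \<gamma> powr (q / p) * e powr (q / p)"
        using ST en k(2) pq by (intro mult_mono powr_mono2) (auto intro!: sum_nonneg)
      finally have "4 powr q * (\<Sum>j\<in>?I. r j powr q * n j) \<le> B powr q"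
        using pq by (simp add: B_def powr_mult powr_powr)
      moreover have "(\<Sum>j\<in>?I. ennreal ((2 powr (1 - real_of_int j)) powr q) * \<nu> (E j))
        = ennreal (4 powr q * (\<Sum>j\<in>?I. r j powr q * n j))"
      proof -
        have "(\<Sum>j\<in>?I. ennreal ((2 powr (1 - real_of_int j)) powr q) * \<nu> (E j))
          = (\<Sum>j\<in>?I. ennreal (4 powr q * (r j powr q * n j)))"
          using n by (intro sum.cong) (simp_all add: r(2) powr_mult ennreal_mult[symmetric] mult.assoc)
        also have "\<dots> = ennreal (\<Sum>j\<in>?I. 4 powr q * (r j powr q * n j))"
          using n(2) by (intro sum_ennreal) auto
        finally show ?thesis by (simp only: sum_distrib_left)
      qed
      ultimately show ?thesis by (simp add: ennreal_leI)
    qed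
    have B0: "0 \<le> B" by (simp add: B_def)
    have "(\<integral>\<^sup>+x\<in>\<Omega>. ennreal (\<bar>u x\<bar> powr q) \<partial>\<nu>.M) \<le> ennreal (B powr q)"
      using \<Omega> u_cont pq(2) bound unfolding E_def by (rule \<nu>.dyadic_levels_bound)
    then have "(\<integral>\<^sup>+x\<in>\<Omega>. ennreal (\<bar>u x\<bar> powr q) \<partial>\<nu>.M) epowr (1 / q) \<le> ennreal (B powr q) epowr (1 / q)"
      using pq by (intro epowr_mono) auto
    also have "\<dots> = ennreal B"
      using pq B0 by (simp add: epowr_ennreal powr_powr)
    also have "\<dots> \<le> ennreal ((4 * \<gamma> powr (1 / p) + 1) * e powr (1 / p))"
      unfolding B_def by (intro ennreal_leI mult_right_mono) auto
    also have "\<dots> = ennreal (4 * \<gamma> powr (1 / p) + 1) * G epowr (1 / p)"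
      using e by (subst ennreal_mult) (auto simp: epowr_ennreal)
    finally show ?thesis .
  qed
  then show "(\<integral>\<^sup>+x\<in>\<Omega>. ennreal (\<bar>u x\<bar> powr q) \<partial>\<nu>.M) epowr (1 / q)
    \<le> ennreal (4 * enn2real (capacitary_gamma \<mu> \<nu> p q \<Omega>) powr (1 / p) + 1)
      * (\<integral>\<^sup>+x\<in>\<Omega>. g x epowr p \<partial>\<mu>.M) epowr (1 / p)"
    by (simp only: G_def \<gamma>_def)
qed

theorem theorem3p9:
  fixes \<mu> \<nu> :: "'a::metric_space set \<Rightarrow> ennreal" and \<Omega> :: "'a set" and p q :: real
  assumes "borel_regular_outer_measure \<mu>"
    and "\<And>x r. 0 < r \<Longrightarrow> 0 < \<mu> (ball x r) \<and> \<mu> (ball x r) < \<infinity>"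
    and "bounded \<Omega>" and "open \<Omega>"
    and "borel_regular_outer_measure \<nu>"
    and "1 \<le> q" and "q < p"
  shows "(capacitary_gamma \<mu> \<nu> p q \<Omega> < \<infinity> \<longrightarrow>
      (\<exists>c::real. 0 \<le> c \<and> (\<forall>u\<in>newtonian_0_cont \<mu> p \<Omega>. \<forall>g.
        weak_upper_gradient \<mu> p (\<lambda>x. ereal (u x)) g \<longrightarrow>
        (\<integral>\<^sup>+x\<in>\<Omega>. ennreal (\<bar>u x\<bar> powr q) \<partial>om_measure \<nu>) epowr (1 / q)
          \<le> ennreal c * (\<integral>\<^sup>+x\<in>\<Omega>. g x epowr p \<partial>om_measure \<mu>) epowr (1 / p)))) \<and>
    ((\<exists>c::real. 0 \<le> c \<and> (\<forall>u\<in>newtonian_0_cont \<mu> p \<Omega>. \<forall>g.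
        weak_upper_gradient \<mu> p (\<lambda>x. ereal (u x)) g \<longrightarrow>
        (\<integral>\<^sup>+x\<in>\<Omega>. ennreal (\<bar>u x\<bar> powr q) \<partial>om_measure \<nu>) epowr (1 / q)
          \<le> ennreal c * (\<integral>\<^sup>+x\<in>\<Omega>. g x epowr p \<partial>om_measure \<mu>) epowr (1 / p))) \<longrightarrow>
      capacitary_gamma \<mu> \<nu> p q \<Omega> < \<infinity>)"
proof -
  have \<mu>: "borel_regular \<mu>" and \<nu>: "borel_regular \<nu>"
    using assms(1,5) by (simp_all add: borel_regular_def)
  interpret \<mu>: borel_regular \<mu> by (rule \<mu>)
  have \<Omega>_fin: "\<mu> \<Omega> < \<infinity>"
  proof -
    obtain a r where "0 < r" "\<Omega> \<subseteq> ball a r"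
      using bounded_subset_ballD[OF assms(3)] by blast
    then show ?thesis
      using \<mu>.outer_mono[of \<Omega> "ball a r"] assms(2)[of r a] by (auto intro: le_less_trans)
  qed
  have "\<exists>c\<ge>0. sobolev_inequality \<mu> \<nu> p q \<Omega> c" if "capacitary_gamma \<mu> \<nu> p q \<Omega> < \<infinity>"
    using sobolev_inequality_of_capacitary_gamma[OF \<mu> \<nu> assms(6,7,4) that]
    by (intro exI[of _ "4 * enn2real (capacitary_gamma \<mu> \<nu> p q \<Omega>) powr (1 / p) + 1"]) auto
  moreover have "capacitary_gamma \<mu> \<nu> p q \<Omega> < \<infinity>" if c: "0 \<le> c" "sobolev_inequality \<mu> \<nu> p q \<Omega> c" for c
  proof -
    \<comment> \<open>A positive constant is needed to divide by it.\<close>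
    have "sobolev_inequality \<mu> \<nu> p q \<Omega> (c + 1)"
      unfolding sobolev_inequality_def
    proof (intro ballI allI impI)
      fix u g assume "u \<in> newtonian_0_cont \<mu> p \<Omega>" "weak_upper_gradient \<mu> p (\<lambda>x. ereal (u x)) g"
      from sobolev_inequalityD[OF c(2) this]
      show "(\<integral>\<^sup>+x\<in>\<Omega>. ennreal (\<bar>u x\<bar> powr q) \<partial>om_measure \<nu>) epowr (1 / q)
        \<le> ennreal (c + 1) * (\<integral>\<^sup>+x\<in>\<Omega>. g x epowr p \<partial>om_measure \<mu>) epowr (1 / p)"
        by (rule order_trans[OF _ mult_right_mono]) (auto intro: ennreal_leI simp del: ennreal_plus)
    qed
    from capacitary_gamma_le[OF \<mu> \<nu> assms(6,7,4) \<Omega>_fin _ this] c(1)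
    have "capacitary_gamma \<mu> \<nu> p q \<Omega> \<le> ennreal (2 * (c + 1) powr p)" by simp
    also have "\<dots> < \<infinity>" unfolding infinity_ennreal_def by (rule ennreal_less_top)
    finally show ?thesis .
  qed
  ultimately show ?thesis
    unfolding sobolev_inequality_def by blast
qed

end
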